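(* There is a family of unsatisfiable CNF formulas $\{F_n\}_{n=0}^\infty$, with $F_n$ having $\Theta(n)$ variables, such that $F_n$ has Polynomial Calculus refutations of constant degree, but every Monomial Calculus refutation of $F_n$ has degree $\Omega(n/\log n)$.
   Context: A CNF formula is refuted in an algebraic system via its polynomial encoding over a field $\mathbb F$: a clause $\bigvee_{x\in P}x\vee\bigvee_{y\in N}\bar y$ becomes $\prod_{x\in P}(1-x)\prod_{y\in N}y$, and Boolean axioms $x_i^2-x_i$ are available. Polynomial Calculus (PC): a refutation of a set $\mathcal P$ of polynomials is a sequence of polynomials ending in $1$, each in $\mathcal P$, a Boolean axiom, or obtained from earlier ones by linear combination $\alpha p+\beta q$ ($\alpha,\beta\in\mathbb F$) or by multiplication $p\mapsto x_ip$ for any variable $x_i$. Monomial Calculus (MC) is the same system except that the multiplication rule may only be applied when $p$ is a monomial or the product of a monomial and an axiom (element of $\mathcal P$ or Boolean axiom). The degree of a refutation is the maximum degree of its polynomials. *)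

theory Defs
  imports Complex_Main "HOL-Library.Poly_Mapping" "HOL-Library.Landau_Symbols"
begin

text \<open>CNF formulas. A clause \<open>(P, N)\<close> is the disjunction of the variables in \<open>P\<close> and of the
  negations of the variables in \<open>N\<close>. Finiteness is not part of the types; see \<open>is_cnf\<close>.\<close>

type_synonym clause = "nat set \<times> nat set"
type_synonym cnf = "clause set"

definition is_cnf :: "cnf \<Rightarrow> bool" where
  "is_cnf F \<longleftrightarrow> finite F \<and> (\<forall>(P, N) \<in> F. finite P \<and> finite N)"

definition cnf_vars :: "cnf \<Rightarrow> nat set" where
  "cnf_vars F = (\<Union>(P, N) \<in> F. P \<union> N)"

definition satisfies :: "(nat \<Rightarrow> bool) \<Rightarrow> cnf \<Rightarrow> bool" where
  "satisfies a F \<longleftrightarrow> (\<forall>(P, N) \<in> F. (\<exists>x\<in>P. a x) \<or> (\<exists>y\<in>N. \<not> a y))"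

definition unsatisfiable :: "cnf \<Rightarrow> bool" where
  "unsatisfiable F \<longleftrightarrow> \<not> (\<exists>a. satisfies a F)"

text \<open>Polynomials in the variables \<open>x\<^sub>0, x\<^sub>1, \<dots>\<close>: finitely supported maps from power products
  (exponent vectors) to coefficients.\<close>

type_synonym 'a mpoly = "(nat \<Rightarrow>\<^sub>0 nat) \<Rightarrow>\<^sub>0 'a"

definition mconst :: "'a::field \<Rightarrow> 'a mpoly" where
  "mconst c = Poly_Mapping.single 0 c"

definition mvar :: "nat \<Rightarrow> 'a::field mpoly" where
  "mvar i = Poly_Mapping.single (Poly_Mapping.single i 1) 1"

text \<open>A monomial may carry a nonzero coefficient.\<close>

definition is_monomial :: "'a::field mpoly \<Rightarrow> bool" where
  "is_monomial p \<longleftrightarrow> (\<exists>m c. c \<noteq> 0 \<and> p = Poly_Mapping.single m c)"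

definition monom_degree :: "(nat \<Rightarrow>\<^sub>0 nat) \<Rightarrow> nat" where
  "monom_degree m = (\<Sum>i\<in>Poly_Mapping.keys m. Poly_Mapping.lookup m i)"

text \<open>Total degree; the zero polynomial gets degree \<open>0\<close>.\<close>

definition mdegree :: "'a::field mpoly \<Rightarrow> nat" where
  "mdegree p = Max (insert 0 (monom_degree ` Poly_Mapping.keys p))"

text \<open>In the encoding, \<open>1\<close> stands for true, and a polynomial vanishes iff its clause is satisfied.\<close>

definition clause_poly :: "clause \<Rightarrow> 'a::field mpoly" where
  "clause_poly C = (case C of (P, N) \<Rightarrow> (\<Prod>x\<in>P. 1 - mvar x) * (\<Prod>y\<in>N. mvar y))"

definition cnf_polys :: "cnf \<Rightarrow> 'a::field mpoly set" where
  "cnf_polys F = clause_poly ` F"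

definition boolean_axioms :: "'a::field mpoly set" where
  "boolean_axioms = range (\<lambda>i. mvar i ^ 2 - mvar i)"

text \<open>Refutations of a set of polynomials \<open>Ps\<close> in which only polynomials satisfying \<open>R\<close> may be
  multiplied by a variable. Polynomial Calculus and Monomial Calculus differ only in \<open>R\<close>.\<close>

definition refutation ::
  "('a::field mpoly \<Rightarrow> bool) \<Rightarrow> 'a mpoly set \<Rightarrow> 'a mpoly list \<Rightarrow> bool" where
  "refutation R Ps ps \<longleftrightarrow>
     ps \<noteq> [] \<and> last ps = 1 \<and>
     (\<forall>k < length ps.
        ps ! k \<in> Ps \<union> boolean_axioms \<or>
        (\<exists>i<k. \<exists>j<k. \<exists>\<alpha> \<beta>. ps ! k = mconst \<alpha> * ps ! i + mconst \<beta> * ps ! j) \<or>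
        (\<exists>j<k. \<exists>i. R (ps ! j) \<and> ps ! k = mvar i * ps ! j))"

definition pc_refutation :: "'a::field mpoly set \<Rightarrow> 'a mpoly list \<Rightarrow> bool" where
  "pc_refutation Ps = refutation (\<lambda>_. True) Ps"

definition mc_refutation :: "'a::field mpoly set \<Rightarrow> 'a mpoly list \<Rightarrow> bool" where
  "mc_refutation Ps = refutation
     (\<lambda>p. is_monomial p \<or> (\<exists>m a. is_monomial m \<and> a \<in> Ps \<union> boolean_axioms \<and> p = m * a)) Ps"

definition refutation_degree :: "'a::field mpoly list \<Rightarrow> nat" where
  "refutation_degree ps = Max (mdegree ` set ps)"

end

theory Submission imports Defs "HOL-Library.FuncSet" begin

text \<open>For a directed acyclic graph of bounded indegree consider the Horn formula saying that a vertex
  is true once its predecessors are true, and that some vertex \<open>s\<close> is false. Polynomial Calculus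
  derives \<open>1 - x\<^sub>v\<close> along a topological order in constant degree. Against Monomial Calculus of degree
  at most \<open>K\<close> use the linear functional that is 1 on a monomial if its variables form a
  configuration of the black pebble game reachable with at most \<open>K\<close> pebbles, and 0 otherwise.
  It kills the multiples of axioms because both monomials of \<open>m * (1 - x\<^sub>v) * \<Prod>x\<^sub>u\<close> are reachable
  or neither is, and it kills the multiples of every monomial that it kills because reachability
  is closed under removing pebbles. Hence the degree exceeds \<open>K\<close> unless \<open>s\<close> can be pebbled with \<open>K\<close> pebbles.

  It remains to find graphs of size \<open>n\<close> requiring of the order of \<open>n / log n\<close> pebbles. This is the recursive
  construction of Paul, Tarjan and Celoni, which stacks two copies of a graph, doubling the number
  of pebbles. Since their argument only loses constant fractions, the superconcentrators can be
  replaced by random bipartite graphs of constant degree.\<close>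

subsection \<open>Pebble counts over time intervals\<close>

text \<open>The half-open interval treats \<open>C a\<close> as the starting position, so that
  consecutive intervals do not overlap.\<close>

definition visited :: "(nat \<Rightarrow> nat set) \<Rightarrow> nat \<Rightarrow> nat \<Rightarrow> nat set" where
  "visited C a b = (\<Union>t\<in>{a<..b}. C t)"

definition placed :: "(nat \<Rightarrow> nat set) \<Rightarrow> nat \<Rightarrow> nat \<Rightarrow> nat set" where
  "placed C a b = (\<Union>t\<in>{a<..b}. C t - C (t - 1))"

text \<open>A move may add several pebbles at once, so predecessors are sought in the new
  configuration. Only vertices below \<open>m\<close> are constrained: the sequence may come from a
  larger graph.\<close>

definition legal :: "nat \<Rightarrow> (nat \<Rightarrow> nat set) \<Rightarrow> (nat \<Rightarrow> nat set) \<Rightarrow> bool" where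
  "legal m pr C \<longleftrightarrow> (\<forall>t. \<forall>w \<in> C (Suc t) - C t. w < m \<longrightarrow> pr w \<subseteq> C (Suc t))"

definition cnt :: "nat \<Rightarrow> nat \<Rightarrow> nat set \<Rightarrow> nat" where
  "cnt s n X = card {j. j < n \<and> s + j \<in> X}"

lemma cnt_mono:
  assumes "\<And>j. j < n \<Longrightarrow> s + j \<in> X \<Longrightarrow> s' + j \<in> Y"
  shows "cnt s n X \<le> cnt s' n Y"
  unfolding cnt_def by (rule card_mono) (use assms in auto)

lemma cnt_Un_le: "cnt s n (X \<union> Y) \<le> cnt s n X + cnt s n Y"
proof -
  have "{j. j < n \<and> s + j \<in> X \<union> Y} = {j. j < n \<and> s + j \<in> X} \<union> {j. j < n \<and> s + j \<in> Y}"
    by auto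
  then show ?thesis
    unfolding cnt_def by (simp add: card_Un_le)
qed

lemma cnt_append: "cnt s (n + n') X = cnt s n X + cnt (s + n) n' X"
proof -
  have "{j. j < n + n' \<and> s + j \<in> X}
      = {j. j < n \<and> s + j \<in> X} \<union> (+) n ` {j. j < n' \<and> s + n + j \<in> X}" (is "_ = ?A \<union> _ ` ?B")
  proof (intro set_eqI iffI)
    fix j assume j: "j \<in> {j. j < n + n' \<and> s + j \<in> X}"
    show "j \<in> ?A \<union> (+) n ` ?B"
    proof (cases "j < n")
      case False
      then have "j = n + (j - n)" "j - n \<in> ?B" using j by auto
      then show ?thesis by blast
    qed (use j in auto)
  qed (auto simp: add.assoc)
  moreover have "card (?A \<union> (+) n ` ?B) = card ?A + card ((+) n ` ?B)"
    by (rule card_Un_disjoint) auto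
  ultimately show ?thesis
    unfolding cnt_def by (simp add: card_image)
qed

lemma cnt_le_whole:
  assumes "s + n \<le> m"
  shows "cnt s n X \<le> cnt 0 m X"
proof -
  have "cnt 0 m X = cnt 0 s X + cnt s n X + cnt (s + n) (m - (s + n)) X"
    using cnt_append[of 0 "s + n" "m - (s + n)" X] cnt_append[of 0 s n X] assms by simp
  then show ?thesis by simp
qed

lemma cnt_shift: "cnt s n {v. q + v \<in> X} = cnt (q + s) n X"
  by (simp add: cnt_def add.assoc)

lemma cnt_le_card: "finite X \<Longrightarrow> cnt s n X \<le> card X"
  unfolding cnt_def by (rule card_inj_on_le[of "(+) s"]) auto

lemma visited_subset: "visited C a b \<subseteq> C a \<union> placed C a b"
proof
  fix x assume "x \<in> visited C a b"
  then obtain t where t: "a < t" "t \<le> b" "x \<in> C t"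
    by (auto simp: visited_def)
  show "x \<in> C a \<union> placed C a b"
  proof (rule ccontr)
    assume x: "x \<notin> C a \<union> placed C a b"
    have "s \<le> b \<Longrightarrow> x \<notin> C s" if "a \<le> s" for s
      using that
    proof (induction s rule: dec_induct)
      case (step s)
      then have "x \<notin> C s" by simp
      moreover have "x \<notin> C (Suc s) - C (Suc s - 1)"
        using x step unfolding placed_def by fastforce
      ultimately show ?case by simp
    qed (use x in auto)
    with t show False by auto
  qed
qed

lemma visited_split:
  assumes "a \<le> t" "t \<le> b"
  shows "visited C a b = visited C a t \<union> visited C t b"
proof -
  have "{a<..b} = {a<..t} \<union> {t<..b}" using assms by auto
  then show ?thesis by (simp add: visited_def)
qed

lemma placed_mono: "a' \<le> a \<Longrightarrow> b \<le> b' \<Longrightarrow> placed C a b \<subseteq> placed C a' b'"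
  unfolding placed_def by (rule UN_mono) auto

lemma placed_preds:
  assumes "legal m pr C" "w \<in> placed C a b" "w < m"
  shows "pr w \<subseteq> visited C a b"
proof -
  obtain t where t: "a < t" "t \<le> b" "w \<in> C t - C (t - 1)"
    using assms(2) by (auto simp: placed_def)
  then have "Suc (t - 1) = t" by simp
  then have "pr w \<subseteq> C t"
    using assms(1,3) t(3) unfolding legal_def by metis
  then show ?thesis using t by (auto simp: visited_def)
qed

text \<open>A vertex visited but not placed in the interval already carries a pebble at time
  \<open>a\<close>. Passing from visited to placed vertices thus costs at most the number of pebbles
  at the start, which is why intervals with a sparse start are sought.\<close>

lemma cnt_visited_le:
  assumes "s + n \<le> m"
  shows "cnt s n (visited C a b) \<le> cnt s n (placed C a b) + cnt 0 m (C a)"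
proof -
  have "cnt s n (visited C a b) \<le> cnt s n (C a \<union> placed C a b)"
    by (rule cnt_mono) (use visited_subset in auto)
  also have "\<dots> \<le> cnt s n (C a) + cnt s n (placed C a b)"
    by (rule cnt_Un_le)
  finally show ?thesis using cnt_le_whole[OF assms, of "C a"] by linarith
qed

text \<open>Along disjoint edges each placement forces its own predecessor to be visited, so the
  count passes down without loss.\<close>

lemma cnt_match:
  assumes "legal m pr C" "s + n \<le> m" "\<And>j. j < n \<Longrightarrow> s' + j \<in> pr (s + j)"
  shows "cnt s n (placed C a b) \<le> cnt s' n (visited C a b)"
proof (rule cnt_mono)
  fix j assume "j < n" "s + j \<in> placed C a b"
  then show "s' + j \<in> visited C a b"
    using placed_preds[OF assms(1), of "s + j" a b] assms(2,3) by auto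
qed

lemma last_low_time:
  fixes low :: "nat \<Rightarrow> bool"
  assumes "low t0" "t0 \<le> a"
  obtains a' where "t0 \<le> a'" "a' \<le> a" "low a'" "\<And>t. a' < t \<Longrightarrow> t \<le> a \<Longrightarrow> \<not> low t"
proof -
  define T where "T = {t. t \<le> a \<and> low t}"
  have fin: "finite T" by (simp add: T_def)
  have "t0 \<in> T" using assms by (simp add: T_def)
  then have in_T: "Max T \<in> T" using Max_in[OF fin] by blast
  show ?thesis
  proof (rule that)
    show "t0 \<le> Max T" by (rule Max_ge[OF fin \<open>t0 \<in> T\<close>])
    show "Max T \<le> a" "low (Max T)" using in_T unfolding T_def by blast+
    fix t assume "Max T < t" "t \<le> a"
    then have "t \<notin> T" using Max_ge[OF fin, of t] leD by blast
    then show "\<not> low t" using \<open>t \<le> a\<close> unfolding T_def by blast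
  qed
qed

text \<open>Consider the earliest time by which \<open>p\<close> vertices of the window are visited.
  Either more than \<open>l\<close> pebbles are present up to then, or some time \<open>t\<close> in
  between is sparse; fewer than \<open>p\<close> vertices are seen before \<open>t\<close> and at
  most \<open>l\<close> at \<open>t\<close>, which leaves at least \<open>q\<close> for
  later.\<close>

lemma low_or_busy:
  assumes "0 < p" "p + q + l \<le> cnt s n (visited C a b)" "s + n \<le> m"
  obtains (low) t where "a < t" "t \<le> b" "cnt 0 m (C t) \<le> l" "q \<le> cnt s n (visited C t b)"
  | (busy) b' where "a \<le> b'" "b' \<le> b" "\<And>t. a < t \<Longrightarrow> t \<le> b' \<Longrightarrow> l < cnt 0 m (C t)"
      "p \<le> cnt s n (visited C a b')"
proof -
  define b' where "b' = (LEAST b'. p \<le> cnt s n (visited C a b'))"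
  have ex: "p \<le> cnt s n (visited C a b)" using assms by simp
  have b': "p \<le> cnt s n (visited C a b')"
    unfolding b'_def by (rule LeastI[of "\<lambda>b'. p \<le> cnt s n (visited C a b')"]) (rule ex)
  have "b' \<le> b" unfolding b'_def by (rule Least_le) (rule ex)
  have "a \<le> b'"
  proof (rule ccontr)
    assume "\<not> a \<le> b'"
    then have "visited C a b' = {}" by (auto simp: visited_def)
    then show False using b' assms(1) by (simp add: cnt_def)
  qed
  show ?thesis
  proof (cases "\<exists>t. a < t \<and> t \<le> b' \<and> cnt 0 m (C t) \<le> l")
    case False
    then show ?thesis using b' \<open>a \<le> b'\<close> \<open>b' \<le> b\<close> by (intro busy[of b']) auto
  next
    case True
    then obtain t where t: "a < t" "t \<le> b'" "cnt 0 m (C t) \<le> l" by blast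
    \<comment> \<open>Minimality of \<open>b'\<close> is applied to \<open>t - 1\<close>, as
      \<open>t\<close> may equal \<open>b'\<close>; the vertices seen at \<open>t\<close> itself are
      charged to \<open>C t\<close>.\<close>
    have "t - 1 < b'" using t by simp
    then have 1: "cnt s n (visited C a (t - 1)) < p"
      unfolding b'_def using not_less_Least[of "t - 1" "\<lambda>b'. p \<le> cnt s n (visited C a b')"] by simp
    have "visited C a t = visited C a (t - 1) \<union> C t"
    proof -
      have "{a<..t} = {a<..t - 1} \<union> {t}" using t(1) by auto
      then show ?thesis by (simp add: visited_def Un_commute)
    qed
    then have eq: "visited C a b = (visited C a (t - 1) \<union> C t) \<union> visited C t b"
      using visited_split[of a t b C] t \<open>b' \<le> b\<close> by simp
    have "cnt s n (visited C a b)
        \<le> cnt s n (visited C a (t - 1)) + cnt s n (C t) + cnt s n (visited C t b)"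
      unfolding eq using cnt_Un_le[of s n "visited C a (t - 1) \<union> C t" "visited C t b"]
        cnt_Un_le[of s n "visited C a (t - 1)" "C t"] by linarith
    then have "q \<le> cnt s n (visited C t b)"
      using 1 t(3) assms(2) cnt_le_whole[OF assms(3), of "C t"] by linarith
    then show ?thesis using t \<open>b' \<le> b\<close> by (intro low[of t]) auto
  qed
qed

subsection \<open>Graphs that are hard to pebble\<close>

text \<open>Union bound by counting: each vertex gets 40 neighbours, repetitions allowed. For a
  large \<open>X\<close> and a small \<open>A\<close>, all neighbours of \<open>X\<close> lie in
  \<open>A\<close> for at most a fraction \<open>(3/4) ^ (40 * card X)\<close>, hence
  \<open>(3/4) ^ (5 * n)\<close>, of the choices. There are at most \<open>4 ^ n\<close> such pairs,
  and \<open>4 * (3/4) ^ 5 < 1\<close>.\<close>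

lemma disperser_exists:
  fixes n :: nat
  assumes "0 < n"
  obtains f :: "nat \<Rightarrow> nat set"
  where "\<And>x. f x \<subseteq> {..<n}" "\<And>x. card (f x) \<le> 40"
    "\<And>X. X \<subseteq> {..<n} \<Longrightarrow> n \<le> 8 * card X \<Longrightarrow> 3 * n \<le> 4 * card (\<Union>x\<in>X. f x)"
proof -
  let ?I = "{..<n} \<times> {..<40::nat}"
  let ?all = "PiE ?I (\<lambda>_. {..<n})"
  define Bad where "Bad X A = PiE ?I (\<lambda>i. if fst i \<in> X then A else {..<n})" for X A
  define Pairs where "Pairs = {(X, A). X \<subseteq> {..<n} \<and> n \<le> 8 * card X \<and> A \<subseteq> {..<n} \<and> 4 * card A < 3 * n}"
  have Pairs_sub: "Pairs \<subseteq> Pow {..<n} \<times> Pow {..<n}" by (auto simp: Pairs_def)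
  have finP: "finite Pairs" by (rule finite_subset[OF Pairs_sub]) auto
  have cardP: "card Pairs \<le> 4 ^ n"
  proof -
    have "card Pairs \<le> card (Pow {..<n} \<times> Pow {..<n})" using Pairs_sub by (intro card_mono) auto
    also have "\<dots> = 2 ^ n * 2 ^ n" by (simp add: card_cartesian_product card_Pow)
    also have "\<dots> = (2 * 2) ^ n" by (rule power_mult_distrib[symmetric])
    finally show ?thesis by simp
  qed
  have bad: "real (card (Bad X A)) \<le> (3/4) ^ (5 * n) * real n ^ (40 * n)" if "(X, A) \<in> Pairs" for X A
  proof -
    have X: "X \<subseteq> {..<n}" "n \<le> 8 * card X" and A: "4 * card A < 3 * n"
      using that by (auto simp: Pairs_def)
    have finX: "finite X" using X(1) finite_subset by blast
    have "real (card (Bad X A)) = (\<Prod>i\<in>?I. if fst i \<in> X then real (card A) else real n)"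
      unfolding Bad_def by (subst card_PiE) (auto simp: intro!: prod.cong)
    also have "\<dots> \<le> (\<Prod>i\<in>?I. (if fst i \<in> X then 3/4 else 1) * real n)"
      by (rule prod_mono) (use A in auto)
    also have "\<dots> = (\<Prod>i\<in>?I. if fst i \<in> X then 3/4 else 1) * real n ^ (40 * n)"
      by (simp add: prod.distrib card_cartesian_product mult.commute)
    also have "(\<Prod>i\<in>?I. if fst i \<in> X then 3/4 else (1::real)) = (\<Prod>i\<in>X \<times> {..<40::nat}. 3/4)"
      by (rule prod.mono_neutral_cong_right) (use X in auto)
    also have "\<dots> = (3/4) ^ (40 * card X)"
      by (simp add: card_cartesian_product mult.commute)
    also have "\<dots> * real n ^ (40 * n) \<le> (3/4) ^ (5 * n) * real n ^ (40 * n)"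
      by (intro mult_right_mono power_decreasing) (use X in auto)
    finally show ?thesis .
  qed
  have "real (card (\<Union>(X, A)\<in>Pairs. Bad X A)) \<le> (\<Sum>(X, A)\<in>Pairs. real (card (Bad X A)))"
    using card_UN_le[OF finP, of "\<lambda>(X, A). Bad X A"] by (simp add: case_prod_beta' flip: of_nat_sum)
  also have "\<dots> \<le> (\<Sum>_\<in>Pairs. (3/4) ^ (5 * n) * real n ^ (40 * n))"
    by (rule sum_mono) (use bad in auto)
  also have "\<dots> \<le> 4 ^ n * ((3/4) ^ (5 * n) * real n ^ (40 * n))"
  proof -
    have "real (card Pairs) \<le> 4 ^ n" using cardP by (metis of_nat_le_iff of_nat_numeral of_nat_power)
    then show ?thesis by (simp only: sum_constant mult_right_mono zero_le_mult_iff zero_le_power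
        of_nat_0_le_iff zero_le_divide_iff zero_le_numeral simp_thms)
  qed
  also have "\<dots> = (4 * (3/4) ^ 5) ^ n * real n ^ (40 * n)"
    by (simp only: power_mult power_mult_distrib mult.assoc)
  also have "\<dots> < 1 * real n ^ (40 * n)"
  proof (rule mult_strict_right_mono)
    have "4 * (3/4) ^ 5 < (1::real)" by (simp add: power_divide)
    then show "(4 * (3/4) ^ 5) ^ n < (1::real)" using assms by (subst power_less_one_iff) auto
  qed (use assms in simp)
  also have "\<dots> = real (card ?all)"
    by (subst card_PiE) (auto simp: card_cartesian_product mult.commute)
  finally have lt: "card (\<Union>(X, A)\<in>Pairs. Bad X A) < card ?all" by simp
  let ?bad = "\<Union>(X, A)\<in>Pairs. Bad X A"
  have "finite (Bad X A)" if "(X, A) \<in> Pairs" for X A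
  proof -
    have "finite A" using that finite_subset[OF _ finite_lessThan] by (auto simp: Pairs_def)
    then show ?thesis unfolding Bad_def by (intro finite_PiE) auto
  qed
  then have "finite ?bad" using finP by (intro finite_UN_I) auto
  then have "\<not> ?all \<subseteq> ?bad"
    using card_mono[of ?bad ?all] lt by linarith
  then obtain g where "g \<in> ?all" "g \<notin> ?bad" unfolding subset_iff not_all not_imp by (elim exE conjE)
  then have g: "g \<in> ?all" "\<And>X A. (X, A) \<in> Pairs \<Longrightarrow> g \<notin> Bad X A"
    by (simp_all only: UN_iff) (metis case_prod_conv)
  \<comment> \<open>The empty default makes the range and degree bounds hold for every
    \<open>x\<close>.\<close>
  define f where "f x = (if x < n then (\<lambda>j. g (x, j)) ` {..<40::nat} else {})" for x
  show ?thesis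
  proof (rule that[of f])
    show f_sub: "f x \<subseteq> {..<n}" for x
    proof (cases "x < n")
      case True
      then have "g (x, j) \<in> {..<n}" if "j < 40" for j
        using PiE_mem[OF g(1), of "(x, j)"] that by simp
      then show ?thesis using True by (auto simp: f_def)
    qed (simp add: f_def)
    show "card (f x) \<le> 40" for x
      using card_image_le[of "{..<40::nat}" "\<lambda>j. g (x, j)"] by (simp add: f_def)
    fix X assume X: "X \<subseteq> {..<n}" "n \<le> 8 * card X"
    show "3 * n \<le> 4 * card (\<Union>x\<in>X. f x)"
    proof (rule ccontr)
      assume "\<not> ?thesis"
      then have "(X, \<Union>x\<in>X. f x) \<in> Pairs"
        using X f_sub by (auto simp: Pairs_def)
      moreover have "g \<in> Bad X (\<Union>x\<in>X. f x)"
        unfolding Bad_def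
      proof (rule PiE_I)
        fix i assume i: "i \<in> ?I"
        then obtain x j where "i = (x, j)" "x < n" "j < 40" by auto
        then show "g i \<in> (if fst i \<in> X then \<Union>x\<in>X. f x else {..<n})"
          using PiE_mem[OF g(1) i] by (auto simp: f_def)
      next
        fix i assume "i \<notin> ?I"
        then show "g i = undefined" by (rule PiE_arb[OF g(1)])
      qed
      ultimately show False using g(2) by blast
    qed
  qed
qed

text \<open>The graph has the vertices \<open>{..<m}\<close>; the first \<open>64 * k\<close> of them are its sources, the last
  \<open>64 * k\<close> its sinks, and each sink is joined directly to the source of the same index. The
  constants 2, 20, 46 are chosen so that the case distinction in \<open>hard_step\<close> reproduces them
  with \<open>2 * k\<close> for \<open>k\<close>.\<close>

definition hard :: "nat \<Rightarrow> nat \<Rightarrow> (nat \<Rightarrow> nat set) \<Rightarrow> bool" where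
  "hard k m pr \<longleftrightarrow>
     64 * k \<le> m \<and> (\<forall>v<m. pr v \<subseteq> {..<v}) \<and> (\<forall>v<64 * k. pr v = {}) \<and>
     (\<forall>v<m. card (pr v) \<le> 64) \<and> (\<forall>j<64 * k. j \<in> pr (m - 64 * k + j)) \<and>
     (\<forall>C a b. legal m pr C \<longrightarrow> a \<le> b \<longrightarrow> cnt 0 m (C a) \<le> 2 * k \<longrightarrow>
        20 * k \<le> cnt (m - 64 * k) (64 * k) (visited C a b) \<longrightarrow>
        (\<exists>a' b'. a \<le> a' \<and> a' \<le> b' \<and> b' \<le> b \<and> (\<forall>t\<in>{a'<..b'}. k \<le> cnt 0 m (C t)) \<and>
          46 * k \<le> cnt 0 (64 * k) (placed C a' b')))"

text \<open>In the complete bipartite graph on 64 sources and 64 sinks, some sink must be placed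
  since 20 exceeds 2, and at that time all sources carry pebbles. From the last time with at most 2
  pebbles until then, at least 62 sources are placed.\<close>

lemma hard_base: "hard 1 128 (\<lambda>v. if v < 64 then {} else {..<64})" (is "hard 1 128 ?pr")
proof -
  have "\<exists>a' b'. a \<le> a' \<and> a' \<le> b' \<and> b' \<le> b \<and> (\<forall>t\<in>{a'<..b'}. 1 \<le> cnt 0 128 (C t)) \<and>
          46 \<le> cnt 0 64 (placed C a' b')"
    if C: "legal 128 ?pr C" and ab: "a \<le> b" and low: "cnt 0 128 (C a) \<le> 2"
      and vis: "20 \<le> cnt 64 64 (visited C a b)" for C a b
  proof -
    have "cnt 64 64 (placed C a b) > 0"
      using cnt_visited_le[of 64 64 128 C a b] low vis by simp
    then obtain j t where j: "j < 64" and t: "a < t" "t \<le> b" "64 + j \<in> C t - C (t - 1)"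
      by (auto simp: cnt_def placed_def card_gt_0_iff)
    have "Suc (t - 1) = t" using t by simp
    then have sub: "{..<64} \<subseteq> C t"
      using C j t(3) unfolding legal_def by (smt (verit) add_less_cancel_left not_add_less1 numeral_Bit0)
    have "\<exists>a'. a \<le> a' \<and> a' \<le> t \<and> cnt 0 128 (C a') \<le> 2 \<and> (\<forall>s. a' < s \<and> s \<le> t \<longrightarrow> 2 < cnt 0 128 (C s))"
      by (rule last_low_time[of "\<lambda>s. cnt 0 128 (C s) \<le> 2" a t]) (use low t in \<open>auto simp: not_le\<close>)
    then obtain a' where a': "a \<le> a'" "a' \<le> t" "cnt 0 128 (C a') \<le> 2"
      and high: "\<And>s. a' < s \<Longrightarrow> s \<le> t \<Longrightarrow> 2 < cnt 0 128 (C s)"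
      by blast
    have 64: "cnt 0 64 (C t) = 64"
      using sub by (auto simp: cnt_def subset_iff cong: conj_cong)
    have "a' < t"
      using a' cnt_le_whole[of 0 64 128 "C t"] 64 by (cases "a' = t") auto
    then have "cnt 0 64 (C t) \<le> cnt 0 64 (visited C a' t)"
      by (intro cnt_mono) (auto simp: visited_def)
    then have "46 \<le> cnt 0 64 (placed C a' t)"
      using cnt_visited_le[of 0 64 128 C a' t] a' 64 by simp
    then show ?thesis
      using a' t high by - (rule exI[of _ a'], rule exI[of _ t], fastforce)
  qed
  then show ?thesis by (auto simp: hard_def)
qed

text \<open>The part of a pebbling inside a translated copy is a legal pebbling of the small graph.
  The sources of the small graph have no predecessors, so edges entering them in the larger graph do
  not affect legality.\<close>

lemma hard_copy:
  assumes "hard k m pr" "legal M pr' C" "s + m \<le> M"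
    and pr': "\<And>u. 64 * k \<le> u \<Longrightarrow> u < m \<Longrightarrow> (+) s ` pr u \<subseteq> pr' (s + u)"
    and "a \<le> b" "cnt s m (C a) \<le> 2 * k" "20 * k \<le> cnt (s + (m - 64 * k)) (64 * k) (visited C a b)"
  obtains a' b' where "a \<le> a'" "a' \<le> b'" "b' \<le> b"
    "\<And>t. a' < t \<Longrightarrow> t \<le> b' \<Longrightarrow> k \<le> cnt s m (C t)" "46 * k \<le> cnt s (64 * k) (placed C a' b')"
proof -
  define C' where "C' t = {v. s + v \<in> C t}" for t
  have vis: "visited C' a b = {v. s + v \<in> visited C a b}" for a b
    by (auto simp: visited_def C'_def)
  have plc: "placed C' a b = {v. s + v \<in> placed C a b}" for a b
    by (auto simp: placed_def C'_def)
  have "pr w \<subseteq> C' (Suc t)" if w: "w \<in> C' (Suc t) - C' t" "w < m" for t w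
  proof (cases "w < 64 * k")
    case True
    then show ?thesis using assms(1) by (simp add: hard_def)
  next
    case False
    have "pr' (s + w) \<subseteq> C (Suc t)"
      using assms(2,3) w unfolding legal_def C'_def by auto
    then show ?thesis using pr'[of w] False w by (auto simp: C'_def)
  qed
  then have "legal m pr C'" by (simp add: legal_def)
  moreover have "cnt 0 m (C' t) = cnt s m (C t)" for t by (simp add: C'_def cnt_shift)
  moreover have "cnt (m - 64 * k) (64 * k) (visited C' a b) = cnt (s + (m - 64 * k)) (64 * k) (visited C a b)"
    by (simp add: vis cnt_shift)
  moreover have "cnt 0 (64 * k) (placed C' a b) = cnt s (64 * k) (placed C a b)" for a b
    by (simp add: plc cnt_shift)
  ultimately have "\<exists>a' b'. a \<le> a' \<and> a' \<le> b' \<and> b' \<le> b \<and> (\<forall>t\<in>{a'<..b'}. k \<le> cnt s m (C t)) \<and>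
          46 * k \<le> cnt s (64 * k) (placed C a' b')"
    using assms(1,5,6,7) unfolding hard_def by metis
  then show ?thesis using that by auto
qed

text \<open>Each residue has at most two preimages below \<open>2 * N\<close>. This bounds the loss
  when a disperser with range \<open>128 * k\<close> is folded onto the \<open>64 * k\<close> sinks
  of a copy.\<close>

lemma card_le_twice_card_mod:
  fixes N :: nat
  assumes "A \<subseteq> {..<2 * N}"
  shows "card A \<le> 2 * card ((\<lambda>y. y mod N) ` A)"
proof -
  have fin: "finite A" using assms finite_subset by blast
  have "A \<subseteq> (\<lambda>y. y mod N) ` A \<union> (+) N ` ((\<lambda>y. y mod N) ` A)"
  proof
    fix y assume y: "y \<in> A"
    have "y = y mod N \<or> y = N + y mod N"
      using assms y le_mod_geq[of N y] by (cases "y < N") auto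
    then show "y \<in> (\<lambda>y. y mod N) ` A \<union> (+) N ` ((\<lambda>y. y mod N) ` A)" using y by blast
  qed
  then have "card A \<le> card ((\<lambda>y. y mod N) ` A \<union> (+) N ` ((\<lambda>y. y mod N) ` A))"
    using fin by (intro card_mono) auto
  also have "\<dots> \<le> card ((\<lambda>y. y mod N) ` A) + card ((+) N ` ((\<lambda>y. y mod N) ` A))"
    by (rule card_Un_le)
  also have "\<dots> = 2 * card ((\<lambda>y. y mod N) ` A)" by (simp add: card_image)
  finally show ?thesis .
qed

text \<open>After a sparse moment, visiting many new sinks requires visiting sinks of the second
  copy, whose hardness gives an interval with \<open>k\<close> pebbles on it. The sources placed
  there force visits to sinks of the first copy. Either more than \<open>2 * k\<close> pebbles are
  present during many of these visits, or a sparse moment inside the interval allows the hardness of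
  the first copy to be used, and the pebbles on the two copies add up.\<close>

lemma hard_step:
  assumes hard: "hard k m pr" and "0 < k"
  obtains pr' where "hard (2 * k) (256 * k + 2 * m) pr'"
proof -
  obtain f :: "nat \<Rightarrow> nat set" where f: "\<And>x. f x \<subseteq> {..<128 * k}" "\<And>x. card (f x) \<le> 40"
    "\<And>X. X \<subseteq> {..<128 * k} \<Longrightarrow> 128 * k \<le> 8 * card X \<Longrightarrow> 3 * (128 * k) \<le> 4 * card (\<Union>x\<in>X. f x)"
    using disperser_exists[of "128 * k"] \<open>0 < k\<close> by auto
  have pr: "64 * k \<le> m" "\<And>v. v < m \<Longrightarrow> pr v \<subseteq> {..<v}" "\<And>v. v < 64 * k \<Longrightarrow> pr v = {}"
     "\<And>v. v < m \<Longrightarrow> card (pr v) \<le> 64" "\<And>j. j < 64 * k \<Longrightarrow> j \<in> pr (m - 64 * k + j)"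
    using hard unfolding hard_def by blast+
  \<comment> \<open>From bottom to top: new sources, first copy (at \<open>s1\<close>), second copy (at \<open>s2\<close>), new sinks (at \<open>s3\<close>).
    Dispersers join the new sources to the first copy and the second copy to the new sinks.\<close>
  define s1 where "s1 = 128 * k"
  define s2 where "s2 = 128 * k + m"
  define s3 where "s3 = 128 * k + 2 * m"
  define M where "M = 256 * k + 2 * m"
  define out where "out = m - 64 * k"
  define pr' where "pr' v =
    (if v < s1 then {} else
     if v < s2 then (if v - s1 < 64 * k then f (v - s1) else (+) s1 ` pr (v - s1)) else
     if v < s3 then (if v - s2 < 64 * k then {s1 + out + (v - s2)} else (+) s2 ` pr (v - s2)) else
     insert (v - s3) ((\<lambda>y. s2 + out + y mod (64 * k)) ` f (v - s3)))" for v
  note defs = s1_def s2_def s3_def M_def out_def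
  have e1: "pr' (s1 + j) = f j" if "j < 64 * k" for j
    using that pr(1) by (simp add: pr'_def defs)
  have e2: "s1 + out + j \<in> pr' (s2 + j)" if "j < 64 * k" for j
    using that pr(1) by (simp add: pr'_def defs)
  have copy1: "(+) s1 ` pr u \<subseteq> pr' (s1 + u)" if "64 * k \<le> u" "u < m" for u
    using that by (simp add: pr'_def defs)
  have copy2: "(+) s2 ` pr u \<subseteq> pr' (s2 + u)" if "64 * k \<le> u" "u < m" for u
    using that by (simp add: pr'_def defs)
  have sink_lt: "out + j < m" if "j < 64 * k" for j using that pr(1) by (simp add: out_def)
  have direct: "j \<in> pr (out + j)" if "j < 64 * k" for j using pr(5)[OF that] by (simp add: out_def)
  \<comment> \<open>The direct edge gives a sink of the copy a predecessor, so it is not a source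
    and its edges are copied.\<close>
  have sink_ge: "64 * k \<le> out + j" if "j < 64 * k" for j
    using pr(3)[of "out + j"] direct[OF that] by (metis empty_iff not_le)
  have d1: "s1 + j \<in> pr' (s1 + out + j)" if "j < 64 * k" for j
    using copy1[OF sink_ge sink_lt, OF that that] direct[OF that] by (auto simp: add.assoc)
  have d2: "s2 + j \<in> pr' (s2 + out + j)" if "j < 64 * k" for j
    using copy2[OF sink_ge sink_lt, OF that that] direct[OF that] by (auto simp: add.assoc)
  have e3: "j \<in> pr' (s3 + j)" "\<And>y. y \<in> f j \<Longrightarrow> s2 + out + y mod (64 * k) \<in> pr' (s3 + j)"
    if "j < 128 * k" for j
    by (auto simp: pr'_def defs)
  have sinks: "M - 64 * (2 * k) = s3" "64 * (2 * k) = 128 * k" by (simp_all add: defs)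
  have "pr' v \<subseteq> {..<v}" if "v < M" for v
  proof -
    have modlt: "y mod (64 * k) < 64 * k" for y using \<open>0 < k\<close> by simp
    consider "v < s1" | "s1 \<le> v" "v < s2" | "s2 \<le> v" "v < s3" | "s3 \<le> v" by linarith
    then show ?thesis
    proof cases
      case 2
      then obtain u where u: "v = s1 + u" "u < m" using le_Suc_ex by (force simp: defs)
      show ?thesis using f(1)[of u] pr(2)[of u] u 2 unfolding pr'_def s1_def by auto
    next
      case 3
      then obtain u where u: "v = s2 + u" "u < m" using le_Suc_ex by (force simp: defs)
      show ?thesis using pr(1) pr(2)[of u] u 3 unfolding pr'_def by (auto simp: defs)
    next
      case 4
      have "s2 + out + y mod (64 * k) < s3" for y
        using modlt[of y] pr(1) by (simp add: defs)
      then have "s2 + out + y mod (64 * k) < v" for y using 4 by (meson less_le_trans)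
      then show ?thesis using 4 \<open>0 < k\<close> by (auto simp: pr'_def defs)
    qed (simp add: pr'_def)
  qed
  moreover have "card (pr' v) \<le> 64" if "v < M" for v
  proof -
    have "card (insert (v - s3) ((\<lambda>y. s2 + out + y mod (64 * k)) ` f (v - s3))) \<le> 64"
    proof -
      have fin: "finite (f (v - s3))" using finite_subset[OF f(1)] by simp
      have "card (insert (v - s3) ((\<lambda>y. s2 + out + y mod (64 * k)) ` f (v - s3)))
          \<le> Suc (card ((\<lambda>y. s2 + out + y mod (64 * k)) ` f (v - s3)))"
        using fin by (simp add: card_insert_if)
      also have "\<dots> \<le> Suc (card (f (v - s3)))" using card_image_le[OF fin] by simp
      finally show ?thesis using f(2)[of "v - s3"] by linarith
    qed
    moreover have "card (f u) \<le> 64" for u using f(2)[of u] by simp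
    ultimately show ?thesis
      using pr(4)[of "v - s1"] pr(4)[of "v - s2"] by (auto simp: pr'_def card_image defs)
  qed
  moreover have "\<exists>a' b'. a \<le> a' \<and> a' \<le> b' \<and> b' \<le> b \<and> (\<forall>t\<in>{a'<..b'}. 2 * k \<le> cnt 0 M (C t)) \<and>
          92 * k \<le> cnt 0 (128 * k) (placed C a' b')"
    if C: "legal M pr' C" and ab: "a \<le> b" and start: "cnt 0 M (C a) \<le> 4 * k"
      and vis: "40 * k \<le> cnt s3 (128 * k) (visited C a b)" for C a b
  proof -
    have le: "s3 + 128 * k \<le> M" "s2 + out + 64 * k \<le> M" "s1 + out + 64 * k \<le> M"
      "s2 + 64 * k \<le> M" "s1 + 64 * k \<le> M" "s1 + m \<le> M" "s2 + m \<le> M" "0 + 128 * k \<le> M"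
      using pr(1) by (simp_all add: defs)
    have blk: "cnt s n (visited C a b) \<le> cnt s n (placed C a b) + l"
      if "s + n \<le> M" "cnt 0 M (C a) \<le> l" for s n a b l
      using cnt_visited_le[OF that(1), of C a b] that(2) by linarith
    \<comment> \<open>\<open>16 * k\<close> is one eighth of the new sinks, the threshold of the
      disperser. Their \<open>96 * k\<close> or more neighbours leave at least \<open>48 * k\<close>
      after folding modulo \<open>64 * k\<close>.\<close>
    have sinks_out2: "48 * k \<le> cnt (s2 + out) (64 * k) (visited C a b)"
      if "16 * k \<le> cnt s3 (128 * k) (placed C a b)" for a b
    proof -
      let ?Y = "\<Union>j\<in>{j. j < 128 * k \<and> s3 + j \<in> placed C a b}. f j"
      have 1: "3 * (128 * k) \<le> 4 * card ?Y"
        by (rule f(3)) (use that f(1) in \<open>auto simp: cnt_def\<close>)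
      have "card ?Y \<le> 2 * card ((\<lambda>y. y mod (64 * k)) ` ?Y)"
        by (rule card_le_twice_card_mod) (use f(1) in auto)
      moreover have "(\<lambda>y. y mod (64 * k)) ` ?Y \<subseteq> {j. j < 64 * k \<and> s2 + out + j \<in> visited C a b}"
      proof -
        have "s2 + out + y mod (64 * k) \<in> visited C a b"
          if "j < 128 * k" "s3 + j \<in> placed C a b" "y \<in> f j" for y j
          using placed_preds[OF C that(2)] e3(2)[OF that(1,3)] that(1) le(1) by auto
        then show ?thesis using \<open>0 < k\<close> by auto
      qed
      then have "card ((\<lambda>y. y mod (64 * k)) ` ?Y) \<le> cnt (s2 + out) (64 * k) (visited C a b)"
        unfolding cnt_def by (intro card_mono) auto
      ultimately show ?thesis using 1 by linarith
    qed
    have in1_src: "96 * k \<le> cnt 0 (128 * k) (visited C a b)"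
      if "16 * k \<le> cnt s1 (64 * k) (placed C a b)" for a b
    proof -
      let ?X = "{j. j < 64 * k \<and> s1 + j \<in> placed C a b}"
      have "3 * (128 * k) \<le> 4 * card (\<Union>j\<in>?X. f j)"
        by (rule f(3)) (use that in \<open>auto simp: cnt_def\<close>)
      moreover have "(\<Union>j\<in>?X. f j) \<subseteq> {j. j < 128 * k \<and> 0 + j \<in> visited C a b}"
      proof -
        have "f j \<subseteq> visited C a b" if "j \<in> ?X" for j
          using placed_preds[OF C, of "s1 + j" a b] e1[of j] that le(5) by auto
        then show ?thesis using f(1) by auto
      qed
      then have "card (\<Union>j\<in>?X. f j) \<le> cnt 0 (128 * k) (visited C a b)"
        unfolding cnt_def by (intro card_mono) auto
      ultimately show ?thesis by linarith
    qed
    note m1 = cnt_match[OF C le(3) d1] and m2 = cnt_match[OF C le(2) d2] and m12 = cnt_match[OF C le(4) e2]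
    note ext = last_low_time[of "\<lambda>t. cnt 0 M (C t) \<le> 2 * k"]
    \<comment> \<open>Of the \<open>40 * k\<close> visited sinks, \<open>20 * k\<close> serve the
      crowded case, \<open>2 * k\<close> are charged to the pebbles at a sparse time, and
      \<open>18 * k\<close> remain after it.\<close>
    have split1: "20 * k + 18 * k + 2 * k \<le> cnt s3 (128 * k) (visited C a b)" using vis by simp
    show ?thesis
    \<comment> \<open>If the configuration stays large while many sinks are visited, the disjoint edges and the two
      dispersers already force many sources to be placed.\<close>
    proof (rule low_or_busy[OF _ split1 le(1)])
      show "0 < 20 * k" using \<open>0 < k\<close> by simp
    next
      fix b' assume b': "a \<le> b'" "b' \<le> b" "\<And>t. a < t \<Longrightarrow> t \<le> b' \<Longrightarrow> 2 * k < cnt 0 M (C t)"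
        "20 * k \<le> cnt s3 (128 * k) (visited C a b')"
      have "16 * k \<le> cnt s3 (128 * k) (placed C a b')"
        using blk[OF le(1) start, of b'] b'(4) by simp
      then have "48 * k \<le> cnt (s2 + out) (64 * k) (visited C a b')" by (rule sinks_out2)
      \<comment> \<open>Four passages from visited to placed vertices cost \<open>4 * k\<close>
        each, the number of pebbles allowed at \<open>a\<close>; this leaves
        \<open>32 * k\<close>.\<close>
      then have "16 * k \<le> cnt s1 (64 * k) (placed C a b')"
        using blk[OF le(2) start, of b'] m2[of a b'] blk[OF le(4) start, of b'] m12[of a b']
          blk[OF le(3) start, of b'] m1[of a b'] blk[OF le(5) start, of b'] by linarith
      then have "96 * k \<le> cnt 0 (128 * k) (visited C a b')" by (rule in1_src)
      then have "92 * k \<le> cnt 0 (128 * k) (placed C a b')"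
        using blk[OF le(8) start, of b'] by simp
      then show ?thesis using b' by - (rule exI[of _ a], rule exI[of _ b'], auto intro: less_imp_le)
    next
      fix t0 assume t0: "a < t0" "t0 \<le> b" "cnt 0 M (C t0) \<le> 2 * k" "18 * k \<le> cnt s3 (128 * k) (visited C t0 b)"
      have "16 * k \<le> cnt s3 (128 * k) (placed C t0 b)"
        using blk[OF le(1) t0(3), of b] t0(4) by simp
      then have out2: "20 * k \<le> cnt (s2 + out) (64 * k) (visited C t0 b)"
        using sinks_out2[of t0 b] by simp
      have low2: "cnt s2 m (C t0) \<le> 2 * k"
        using cnt_le_whole[OF le(7), of "C t0"] t0(3) by simp
      obtain a1 b1 where ab1: "t0 \<le> a1" "a1 \<le> b1" "b1 \<le> b"
        and high2: "\<And>t. a1 < t \<Longrightarrow> t \<le> b1 \<Longrightarrow> k \<le> cnt s2 m (C t)"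
        and in2: "46 * k \<le> cnt s2 (64 * k) (placed C a1 b1)"
        using hard_copy[OF hard C le(7) copy2 t0(2) low2 out2[unfolded out_def]] by blast
      \<comment> \<open>Extending the interval back to the last time with few pebbles turns visited sources
        into placed ones.\<close>
      have finish: ?thesis
        if ab: "t0 \<le> a2" "a2 \<le> b2" "b2 \<le> b"
          and hi: "\<And>t. a2 < t \<Longrightarrow> t \<le> b2 \<Longrightarrow> 2 * k \<le> cnt 0 M (C t)"
          and big: "20 * k \<le> cnt (s1 + out) (64 * k) (visited C a2 b2) \<or> 46 * k \<le> cnt s1 (64 * k) (placed C a2 b2)"
        for a2 b2
      proof -
        obtain a3 where a3: "t0 \<le> a3" "a3 \<le> a2" "cnt 0 M (C a3) \<le> 2 * k"
          "\<And>t. a3 < t \<Longrightarrow> t \<le> a2 \<Longrightarrow> \<not> cnt 0 M (C t) \<le> 2 * k"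
          by (rule ext[OF t0(3) ab(1)]) blast
        have "cnt (s1 + out) (64 * k) (visited C a2 b2) \<le> cnt (s1 + out) (64 * k) (visited C a3 b2)"
          by (rule cnt_mono) (use a3(2) in \<open>auto simp: visited_def\<close>)
        moreover have "cnt s1 (64 * k) (placed C a2 b2) \<le> cnt s1 (64 * k) (placed C a3 b2)"
          by (rule cnt_mono) (use placed_mono[OF a3(2) order_refl] in auto)
        ultimately have "16 * k \<le> cnt s1 (64 * k) (placed C a3 b2)"
          using big blk[OF le(3) a3(3), of b2] m1[of a3 b2] blk[OF le(5) a3(3), of b2] by linarith
        then have "96 * k \<le> cnt 0 (128 * k) (visited C a3 b2)" by (rule in1_src)
        then have "92 * k \<le> cnt 0 (128 * k) (placed C a3 b2)"
          using blk[OF le(8) a3(3), of b2] by simp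
        moreover have "2 * k \<le> cnt 0 M (C t)" if "a3 < t" "t \<le> b2" for t
          using a3(4)[of t] hi[of t] that by (cases "t \<le> a2") auto
        ultimately show ?thesis
          using t0 a3 ab by - (rule exI[of _ a3], rule exI[of _ b2], auto)
      qed
      \<comment> \<open>At least \<open>46 * k\<close> sinks of the first copy are visited through
        the matching edges; \<open>42 * k\<close> suffice to give both branches
        \<open>20 * k\<close>.\<close>
      have split2: "20 * k + 20 * k + 2 * k \<le> cnt (s1 + out) (64 * k) (visited C a1 b1)"
        using m12[of a1 b1] in2 by linarith
      show ?thesis
      proof (rule low_or_busy[OF _ split2 le(3)])
        show "0 < 20 * k" using \<open>0 < k\<close> by simp
      next
        fix b' assume "a1 \<le> b'" "b' \<le> b1" "\<And>t. a1 < t \<Longrightarrow> t \<le> b' \<Longrightarrow> 2 * k < cnt 0 M (C t)"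
          "20 * k \<le> cnt (s1 + out) (64 * k) (visited C a1 b')"
        then show ?thesis using ab1 by (intro finish[of a1 b']) (auto intro: less_imp_le)
      next
        fix t1 assume t1: "a1 < t1" "t1 \<le> b1" "cnt 0 M (C t1) \<le> 2 * k"
          "20 * k \<le> cnt (s1 + out) (64 * k) (visited C t1 b1)"
        have low1: "cnt s1 m (C t1) \<le> 2 * k"
          using cnt_le_whole[OF le(6), of "C t1"] t1(3) by simp
        obtain a2 b2 where ab2: "t1 \<le> a2" "a2 \<le> b2" "b2 \<le> b1"
          and high1: "\<And>t. a2 < t \<Longrightarrow> t \<le> b2 \<Longrightarrow> k \<le> cnt s1 m (C t)"
          and in1: "46 * k \<le> cnt s1 (64 * k) (placed C a2 b2)"
          using hard_copy[OF hard C le(6) copy1 t1(2) low1 t1(4)[unfolded out_def]] by blast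
        \<comment> \<open>The doubling: this interval lies within the one from \<open>a1\<close> to
          \<open>b1\<close>, so each of the two disjoint copies holds at least \<open>k\<close>
          pebbles.\<close>
        have "2 * k \<le> cnt 0 M (C t)" if "a2 < t" "t \<le> b2" for t
        proof -
          have "cnt s1 m (C t) + cnt s2 m (C t) = cnt s1 (m + m) (C t)"
            by (simp add: cnt_append s1_def s2_def)
          also have "\<dots> \<le> cnt 0 M (C t)"
            by (rule cnt_le_whole) (simp add: defs)
          finally show ?thesis
            using high1[OF that] high2[of t] that t1 ab2 by simp
        qed
        then show ?thesis using ab1 t1 ab2 in1 by (intro finish[of a2 b2]) auto
      qed
    qed
  qed
  ultimately have "hard (2 * k) M pr'"
    unfolding hard_def sinks using e3(1) pr(1) by (auto simp: pr'_def defs)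
  then show ?thesis by (intro that[of pr']) (simp add: M_def)
qed

text \<open>Starting from size 128 at \<open>k = 1\<close>, the recursion
  \<open>256 * k + 2 * m\<close> yields size of order \<open>k log k\<close>, the source of the
  logarithm in the bound.\<close>

lemma hard_exists: "\<exists>pr. hard (2 ^ i) (128 * 2 ^ i * (i + 1)) pr"
proof (induction i)
  case 0
  then show ?case using hard_base by auto
next
  case (Suc i)
  then obtain pr where "hard (2 ^ i) (128 * 2 ^ i * (i + 1)) pr" by blast
  then obtain pr' where "hard (2 * 2 ^ i) (256 * 2 ^ i + 2 * (128 * 2 ^ i * (i + 1))) pr'"
    by (rule hard_step) simp
  then show ?case by (auto simp: algebra_simps)
qed

subsection \<open>Reachable configurations\<close>

text \<open>A move may remove and add any number of pebbles at once, as in \<open>legal\<close>; in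
  particular, passing to a subset is a single move.\<close>

definition pebble_step :: "nat \<Rightarrow> (nat \<Rightarrow> nat set) \<Rightarrow> nat \<Rightarrow> nat set \<Rightarrow> nat set \<Rightarrow> bool" where
  "pebble_step M pr K A B \<longleftrightarrow> B \<subseteq> {..<M} \<and> card B \<le> K \<and> (\<forall>w \<in> B - A. pr w \<subseteq> B)"

definition reachable :: "nat \<Rightarrow> (nat \<Rightarrow> nat set) \<Rightarrow> nat \<Rightarrow> nat set set" where
  "reachable M pr K = {A. (pebble_step M pr K)\<^sup>*\<^sup>* {} A}"

lemma reachable_step: "A \<in> reachable M pr K \<Longrightarrow> pebble_step M pr K A B \<Longrightarrow> B \<in> reachable M pr K"
  unfolding reachable_def by auto

lemma reachable_empty: "{} \<in> reachable M pr K"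
  by (simp add: reachable_def)

lemma reachable_bounds:
  assumes "A \<in> reachable M pr K"
  shows "A \<subseteq> {..<M} \<and> card A \<le> K"
proof -
  have "(pebble_step M pr K)\<^sup>*\<^sup>* {} A" using assms by (simp add: reachable_def)
  then show ?thesis by (cases rule: rtranclp.cases) (auto simp: pebble_step_def)
qed

lemma reachable_subset:
  assumes "A \<in> reachable M pr K" "B \<subseteq> A"
  shows "B \<in> reachable M pr K"
proof -
  have "A \<subseteq> {..<M}" "card A \<le> K" using reachable_bounds[OF assms(1)] by auto
  moreover from this have "card B \<le> card A"
    using assms(2) by (intro card_mono) (auto intro: finite_subset)
  ultimately have "pebble_step M pr K A B" using assms(2) by (auto simp: pebble_step_def)
  then show ?thesis using reachable_step assms(1) by blast
qed

lemma reachable_insert: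
  assumes "A \<in> reachable M pr K" "v < M" "pr v \<subseteq> A" "card (insert v A) \<le> K"
  shows "insert v A \<in> reachable M pr K"
proof -
  have "pebble_step M pr K A (insert v A)"
    using reachable_bounds[OF assms(1)] assms(2-) by (auto simp: pebble_step_def)
  then show ?thesis using reachable_step assms(1) by blast
qed

text \<open>Pebblings that reach the individual vertices are concatenated, clearing the board in
  between. Hardness speaks of one sequence, whereas reachability treats the vertices one at a
  time.\<close>

lemma walk_through:
  assumes "finite S" "\<And>s. s \<in> S \<Longrightarrow> \<exists>A \<in> reachable M pr K. s \<in> A"
  shows "\<exists>C T. C 0 = {} \<and> (\<forall>t. pebble_step M pr K (C t) (C (Suc t))) \<and> S \<subseteq> visited C 0 T"
  using assms
proof (induction S rule: finite_induct)
  case empty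
  show ?case by (intro exI[of _ "\<lambda>_. {}"]) (auto simp: pebble_step_def)
next
  case (insert s S)
  then obtain C T where C: "C 0 = {}" "\<And>t. pebble_step M pr K (C t) (C (Suc t))" "S \<subseteq> visited C 0 T"
    by auto
  obtain A where A: "A \<in> reachable M pr K" "s \<in> A" using insert by blast
  then obtain n where "((pebble_step M pr K) ^^ n) {} A"
    using rtranclp_imp_relpowp unfolding reachable_def by fastforce
  then obtain g where g: "g 0 = {}" "g n = A" "\<And>i. i < n \<Longrightarrow> pebble_step M pr K (g i) (g (Suc i))"
    unfolding relpowp_fun_conv by blast
  have stay: "pebble_step M pr K A A"
    using reachable_bounds[OF A(1)] by (auto simp: pebble_step_def)
  \<comment> \<open>At time \<open>Suc T\<close> the board is \<open>g 0 = {}\<close>, a legal move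
    since it only removes pebbles; \<open>min\<close> freezes the sequence once \<open>A\<close> is
    reached.\<close>
  define h where "h t = (if t \<le> T then C t else g (min (t - Suc T) n))" for t
  have step: "pebble_step M pr K (h t) (h (Suc t))" for t
  proof -
    consider "t < T" | "t = T" | "T < t" "t - Suc T < n" | "T < t" "n \<le> t - Suc T" by linarith
    then show ?thesis
    proof cases
      case 1
      then show ?thesis using C(2) by (simp add: h_def)
    next
      case 2
      then show ?thesis using g(1) by (simp add: h_def pebble_step_def)
    next
      case 3
      then have "Suc t - Suc T = Suc (t - Suc T)" by simp
      then show ?thesis using 3 g(3)[OF 3(2)] by (simp add: h_def min_absorb1)
    next
      case 4
      then show ?thesis using g(2) stay by (simp add: h_def min_absorb2)
    qed
  qed
  have "insert s S \<subseteq> visited h 0 (Suc T + n)"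
  proof -
    have "s \<in> h (Suc T + n)" using A(2) g(2) by (simp add: h_def)
    then have "s \<in> visited h 0 (Suc T + n)" by (auto simp: visited_def)
    moreover have "visited C 0 T \<subseteq> visited h 0 (Suc T + n)"
      unfolding visited_def h_def by fastforce
    ultimately show ?thesis using C(3) by blast
  qed
  moreover have "h 0 = {}" using C(1) by (simp add: h_def)
  ultimately show ?case using step by blast
qed

text \<open>If every sink were reachable with \<open>K\<close> pebbles, one legal sequence would
  visit them all, and hardness would supply a time with at least \<open>k\<close> pebbles. The
  vertices from \<open>m\<close> on are isolated padding.\<close>

lemma hard_unreachable:
  assumes hard: "hard k m pr" and "m \<le> M" "K < k"
  obtains s where "s < m" "\<And>A. A \<in> reachable M (\<lambda>v. if v < m then pr v else {}) K \<Longrightarrow> s \<notin> A"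
proof -
  let ?pr = "\<lambda>v. if v < m then pr v else {}"
  have m: "64 * k \<le> m" using hard by (simp add: hard_def)
  have "\<exists>s\<in>{m - 64 * k..<m}. \<forall>A \<in> reachable M ?pr K. s \<notin> A"
  proof (rule ccontr)
    assume "\<not> ?thesis"
    then have "\<exists>A \<in> reachable M ?pr K. s \<in> A" if "s \<in> {m - 64 * k..<m}" for s
      using that by blast
    then obtain C T where C: "C 0 = {}" "\<And>t. pebble_step M ?pr K (C t) (C (Suc t))"
      "{m - 64 * k..<m} \<subseteq> visited C 0 T"
      using walk_through[of "{m - 64 * k..<m}" M ?pr K] by auto
    have "?pr w \<subseteq> C (Suc t)" if "w \<in> C (Suc t) - C t" for t w
      using C(2)[of t] that unfolding pebble_step_def by blast
    then have "legal m pr C" unfolding legal_def by (metis (full_types))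
    moreover have "cnt 0 m (C 0) \<le> 2 * k" using C(1) by (simp add: cnt_def)
    moreover have "20 * k \<le> cnt (m - 64 * k) (64 * k) (visited C 0 T)"
    proof -
      have "m - 64 * k + j \<in> visited C 0 T" if "j < 64 * k" for j
        by (rule subsetD[OF C(3)]) (use that m in \<open>unfold atLeastLessThan_iff, arith\<close>)
      then have "{j. j < 64 * k \<and> m - 64 * k + j \<in> visited C 0 T} = {..<64 * k}" by blast
      then show ?thesis by (simp add: cnt_def)
    qed
    ultimately obtain a b where ab: "a \<le> b" "\<forall>t\<in>{a<..b}. k \<le> cnt 0 m (C t)"
      "46 * k \<le> cnt 0 (64 * k) (placed C a b)"
      using hard unfolding hard_def by (metis zero_le)
    \<comment> \<open>Some source is placed, so the interval is nonempty and its pebble bound is not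
      vacuous.\<close>
    have "a < b"
    proof (rule ccontr)
      assume "\<not> a < b"
      then have "placed C a b = {}" by (auto simp: placed_def)
      then show False using ab(3) \<open>K < k\<close> by (simp add: cnt_def)
    qed
    then obtain b' where b': "b = Suc b'" by (cases b) auto
    have "k \<le> cnt 0 m (C b)" using ab(2) \<open>a < b\<close> by auto
    also have "\<dots> \<le> card (C b)"
      using C(2)[of b'] by (intro cnt_le_card) (auto simp: b' pebble_step_def intro: finite_subset)
    also have "\<dots> \<le> K" using C(2)[of b'] by (simp add: b' pebble_step_def)
    finally show False using \<open>K < k\<close> by simp
  qed
  then obtain s where "s < m" "\<forall>A \<in> reachable M ?pr K. s \<notin> A" by auto
  then show ?thesis by (intro that[of s]) auto
qed

subsection \<open>The degree lower bound for Monomial Calculus\<close>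

definition horn_cnf :: "nat \<Rightarrow> (nat \<Rightarrow> nat set) \<Rightarrow> nat \<Rightarrow> cnf" where
  "horn_cnf M pr s = insert ({}, {s}) ((\<lambda>v. ({v}, pr v)) ` {..<M})"

abbreviation keys :: "('a \<Rightarrow>\<^sub>0 'b::zero) \<Rightarrow> 'a set" where
  "keys \<equiv> Poly_Mapping.keys"

abbreviation lookup :: "('a \<Rightarrow>\<^sub>0 'b::zero) \<Rightarrow> 'a \<Rightarrow> 'b" where
  "lookup \<equiv> Poly_Mapping.lookup"

section \<open>Degrees of monomials and the configuration functional\<close>

lemma keys_plus_nat: "keys (m + n) = keys m \<union> keys (n :: nat \<Rightarrow>\<^sub>0 nat)"
  by (auto simp: in_keys_iff lookup_add)

lemma lookup_mconst_mult: "lookup (mconst c * p) m = c * lookup p m"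
  unfolding mconst_def mult_map_scale_conv_mult[symmetric] by (simp add: map.rep_eq when_def)

lemma monom_degree_superset:
  assumes "finite S" "keys m \<subseteq> S"
  shows "monom_degree m = (\<Sum>i\<in>S. lookup m i)"
  unfolding monom_degree_def by (rule sum.mono_neutral_left) (use assms in \<open>auto simp: in_keys_iff\<close>)

lemma monom_degree_add: "monom_degree (m + n) = monom_degree m + monom_degree n"
proof -
  let ?S = "keys m \<union> keys n"
  have "monom_degree (m + n) = (\<Sum>i\<in>?S. lookup (m + n) i)"
    by (rule monom_degree_superset) (auto simp: keys_plus_nat)
  also have "\<dots> = monom_degree m + monom_degree n"
    by (simp add: lookup_add sum.distrib monom_degree_superset[of ?S])
  finally show ?thesis .
qed

lemma card_keys_le_monom_degree: "card (keys m) \<le> monom_degree m"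
proof -
  have "(\<Sum>i\<in>keys m. 1) \<le> (\<Sum>i\<in>keys m. lookup m i)"
    by (rule sum_mono) (auto simp: in_keys_iff)
  then show ?thesis by (simp add: monom_degree_def)
qed

lemma mdegree_le_iff: "mdegree p \<le> d \<longleftrightarrow> (\<forall>m\<in>keys p. monom_degree m \<le> d)"
  by (simp add: mdegree_def)

text \<open>Each monomial is evaluated to 1 or 0 according to whether its set of variables is a
  configuration in \<open>R\<close>; this is linear but not multiplicative.\<close>

definition config_eval :: "nat set set \<Rightarrow> 'a::field mpoly \<Rightarrow> 'a" where
  "config_eval R p = (\<Sum>m\<in>keys p. if keys m \<in> R then lookup p m else 0)"

lemma config_eval_superset:
  assumes "finite S" "keys p \<subseteq> S"
  shows "config_eval R p = (\<Sum>m\<in>S. if keys m \<in> R then lookup p m else 0)"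
  unfolding config_eval_def
  by (rule sum.mono_neutral_left) (use assms in \<open>auto simp: in_keys_iff\<close>)

lemma config_eval_add: "config_eval R (p + q) = config_eval R p + config_eval R q"
proof -
  let ?S = "keys p \<union> keys q"
  have "config_eval R (p + q) = (\<Sum>m\<in>?S. if keys m \<in> R then lookup (p + q) m else 0)"
    by (rule config_eval_superset) (use keys_add[of p q] in auto)
  also have "\<dots> = (\<Sum>m\<in>?S. (if keys m \<in> R then lookup p m else 0) + (if keys m \<in> R then lookup q m else 0))"
    by (rule sum.cong) (auto simp: lookup_add)
  also have "\<dots> = config_eval R p + config_eval R q"
    by (simp add: sum.distrib config_eval_superset[of ?S])
  finally show ?thesis .
qed

lemma config_eval_mconst: "config_eval R (mconst c * p) = c * config_eval R p"
proof -
  have "config_eval R (mconst c * p) = (\<Sum>m\<in>keys p. if keys m \<in> R then lookup (mconst c * p) m else 0)"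
    by (rule config_eval_superset) (auto simp: in_keys_iff lookup_mconst_mult)
  also have "\<dots> = c * config_eval R p"
    by (simp add: config_eval_def sum_distrib_left lookup_mconst_mult if_distrib cong: if_cong)
  finally show ?thesis .
qed

lemma config_eval_single: "config_eval R (Poly_Mapping.single m c) = (if keys m \<in> R then c else 0)"
  by (simp add: config_eval_def)

lemma config_eval_diff_single:
  "config_eval R (Poly_Mapping.single m c - Poly_Mapping.single n c)
    = (if keys m \<in> R then c else 0) - (if keys n \<in> R then c else 0)"
  using config_eval_add[of R "Poly_Mapping.single m c" "Poly_Mapping.single n (- c)"]
  by (simp add: config_eval_single) (simp add: single_uminus)

definition indicator_exp :: "nat set \<Rightarrow> (nat \<Rightarrow>\<^sub>0 nat)" where
  "indicator_exp S = (\<Sum>y\<in>S. Poly_Mapping.single y 1)"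

lemma keys_indicator_exp: "finite S \<Longrightarrow> keys (indicator_exp S) = S"
  by (induction S rule: finite_induct) (simp_all add: indicator_exp_def keys_plus_nat)

lemma prod_mvar: "finite S \<Longrightarrow> (\<Prod>y\<in>S. mvar y) = (Poly_Mapping.single (indicator_exp S) 1 :: 'a::field mpoly)"
  by (induction S rule: finite_induct) (simp_all add: indicator_exp_def mvar_def mult_single)

text \<open>A single positive literal makes the clause polynomial a difference of two monomials,
  whose variable sets are the configurations before and after pebbling \<open>v\<close>.\<close>

lemma clause_poly_rule:
  assumes "finite S"
  shows "clause_poly ({v}, S) = (Poly_Mapping.single (indicator_exp S) 1
     - Poly_Mapping.single (Poly_Mapping.single v 1 + indicator_exp S) 1 :: 'a::field mpoly)"
  using assms by (simp add: clause_poly_def prod_mvar left_diff_distrib)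
    (simp add: mvar_def mult_single)

lemma clause_poly_target: "clause_poly ({}, {s}) = (mvar s :: 'a::field mpoly)"
  by (simp add: clause_poly_def)

lemma boolean_axiom_singles:
  "mvar i ^ 2 - mvar i = (Poly_Mapping.single (Poly_Mapping.single i 2) 1 -
     Poly_Mapping.single (Poly_Mapping.single i 1) 1 :: 'a::field mpoly)"
  by (simp add: mvar_def power2_eq_square mult_single numeral_2_eq_2 flip: single_add)

section \<open>The functional annihilates every line of low degree\<close>

locale horn_pebbling =
  fixes M K s :: nat and pr :: "nat \<Rightarrow> nat set"
  assumes finite_pr: "\<And>v. v < M \<Longrightarrow> finite (pr v)"
    and unreachable: "\<And>A. A \<in> reachable M pr K \<Longrightarrow> s \<notin> A"
begin

text \<open>Boolean axioms give two monomials with the same variables, the target clause gives a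
  monomial containing \<open>s\<close>, and a rule gives configurations \<open>A\<close> and
  \<open>insert v A\<close> with the predecessors of \<open>v\<close> in \<open>A\<close>. The
  degree bound provides the pebble for \<open>v\<close>.\<close>

lemma config_eval_axiom_multiple:
  fixes a :: "'a::field mpoly"
  assumes "is_monomial p" "a \<in> cnf_polys (horn_cnf M pr s) \<union> boolean_axioms" "mdegree (p * a) \<le> K"
  shows "config_eval (reachable M pr K) (p * a) = 0"
proof -
  obtain m c where c: "c \<noteq> 0" and p: "p = Poly_Mapping.single m c"
    using assms(1) by (auto simp: is_monomial_def)
  consider i where "a = mvar i ^ 2 - mvar i" | "a = mvar s"
    | v where "v < M" "a = clause_poly ({v}, pr v)"
    using assms(2) by (auto simp: cnf_polys_def horn_cnf_def boolean_axioms_def clause_poly_target)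
  then show ?thesis
  proof cases
    case 1
    have "p * a = Poly_Mapping.single (m + Poly_Mapping.single i 2) c
        - Poly_Mapping.single (m + Poly_Mapping.single i 1) c"
      unfolding 1 boolean_axiom_singles p by (simp add: right_diff_distrib mult_single)
    then show ?thesis by (simp add: config_eval_diff_single keys_plus_nat)
  next
    case 2
    have "p * a = Poly_Mapping.single (m + Poly_Mapping.single s 1) c"
      unfolding 2 mvar_def p by (simp add: mult_single)
    then show ?thesis using unreachable by (auto simp: config_eval_single keys_plus_nat)
  next
    case 3
    let ?A = "keys m \<union> pr v"
    let ?m0 = "m + indicator_exp (pr v)" and ?m1 = "m + (Poly_Mapping.single v 1 + indicator_exp (pr v))"
    have fin: "finite (pr v)" using finite_pr 3(1) .
    have pa: "p * a = Poly_Mapping.single ?m0 c - Poly_Mapping.single ?m1 c"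
      unfolding 3(2) clause_poly_rule[OF fin] p by (simp add: right_diff_distrib mult_single)
    have k0: "keys ?m0 = ?A" and k1: "keys ?m1 = insert v ?A"
      using keys_indicator_exp[OF fin] by (simp_all add: keys_plus_nat)
    \<comment> \<open>The exponents of \<open>v\<close> differ even if \<open>v\<close> occurs in
      both, so the monomials do not cancel and the degree bound applies to the larger one.\<close>
    have "?m0 \<noteq> ?m1"
    proof
      assume "?m0 = ?m1"
      then have "lookup ?m0 v = lookup ?m1 v" by simp
      then show False by (simp add: lookup_add)
    qed
    then have "?m1 \<in> keys (p * a)"
      using c by (simp add: pa in_keys_iff lookup_minus lookup_single when_def)
    then have "card (insert v ?A) \<le> K"
      using assms(3) card_keys_le_monom_degree[of ?m1] k1 by (auto simp: mdegree_le_iff)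
    then have "?A \<in> reachable M pr K \<longleftrightarrow> insert v ?A \<in> reachable M pr K"
      using reachable_insert[of ?A M pr K v] reachable_subset[of "insert v ?A" M pr K ?A] 3(1) by auto
    then show ?thesis unfolding pa config_eval_diff_single k0 k1 by simp
  qed
qed

text \<open>By induction every line of a refutation of degree at most \<open>K\<close> is sent to 0,
  whereas \<open>1\<close> is sent to 1 because the empty configuration is reachable.\<close>

lemma mc_degree_lower_bound:
  fixes ps :: "'a::field mpoly list"
  assumes "mc_refutation (cnf_polys (horn_cnf M pr s)) ps"
  shows "K < refutation_degree ps"
proof (rule ccontr)
  assume "\<not> ?thesis"
  then have deg: "mdegree p \<le> K" if "p \<in> set ps" for p
    using that Max_ge[of "mdegree ` set ps" "mdegree p"] unfolding refutation_degree_def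
    by (meson finite_imageI finite_set imageI le_trans not_less)
  let ?R = "reachable M pr K" and ?Ax = "cnf_polys (horn_cnf M pr s) \<union> boolean_axioms :: 'a mpoly set"
  have ps: "ps \<noteq> []" "last ps = 1"
    and lines: "\<And>k. k < length ps \<Longrightarrow> ps ! k \<in> ?Ax \<or>
        (\<exists>i<k. \<exists>j<k. \<exists>\<alpha> \<beta>. ps ! k = mconst \<alpha> * ps ! i + mconst \<beta> * ps ! j) \<or>
        (\<exists>j<k. \<exists>i. (is_monomial (ps ! j) \<or> (\<exists>m a. is_monomial m \<and> a \<in> ?Ax \<and> ps ! j = m * a))
            \<and> ps ! k = mvar i * ps ! j)"
    using assms unfolding mc_refutation_def refutation_def by blast+
  have is_monomial_1: "is_monomial (1 :: 'a mpoly)"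
    unfolding is_monomial_def by (metis single_one zero_neq_one)
  have "config_eval ?R (ps ! k) = 0" if "k < length ps" for k
    using that
  proof (induction k rule: less_induct)
    case (less k)
    have d: "mdegree (ps ! k) \<le> K" using deg less.prems by simp
    consider "ps ! k \<in> ?Ax"
      | i j \<alpha> \<beta> where "i < k" "j < k" "ps ! k = mconst \<alpha> * ps ! i + mconst \<beta> * ps ! j"
      | i j where "j < k" "is_monomial (ps ! j)" "ps ! k = mvar i * ps ! j"
      | i m a where "is_monomial m" "a \<in> ?Ax" "ps ! k = mvar i * (m * a)"
      using lines[OF less.prems] by metis
    then show ?case
    proof cases
      case 1
      then show ?thesis using config_eval_axiom_multiple[OF is_monomial_1 1] d by simp
    next
      case 2
      then show ?thesis using less.IH[of i] less.IH[of j] less.prems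
        by (simp add: config_eval_add config_eval_mconst)
    next
      case 3
      then obtain m c where c: "c \<noteq> 0" "ps ! j = Poly_Mapping.single m c"
        by (auto simp: is_monomial_def)
      \<comment> \<open>Since \<open>c\<close> is nonzero, a monomial that is sent to 0 has an
        unreachable configuration, and multiplication by a variable only enlarges it.\<close>
      then have "keys m \<notin> ?R"
        using less.IH[of j] 3(1) less.prems by (auto simp: config_eval_single split: if_splits)
      then have "keys (Poly_Mapping.single i 1 + m) \<notin> ?R"
        using reachable_subset[of "keys (Poly_Mapping.single i 1 + m)" M pr K "keys m"]
        by (auto simp: keys_plus_nat)
      then show ?thesis unfolding 3(3) c(2) mvar_def by (simp add: mult_single config_eval_single)
    next
      \<comment> \<open>The new line is again a monomial multiple of the axiom \<open>a\<close>.
        Here and in the previous case the restriction on multiplication enters.\<close>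
      case 4
      obtain e c where "c \<noteq> 0" "m = Poly_Mapping.single e c"
        using 4(1) by (auto simp: is_monomial_def)
      then have "is_monomial (mvar i * m)" by (auto simp: is_monomial_def mvar_def mult_single)
      then show ?thesis using config_eval_axiom_multiple[of "mvar i * m" a] 4 d by (simp add: mult.assoc)
    qed
  qed
  then have "config_eval ?R (last ps) = 0" using ps(1) by (simp add: last_conv_nth)
  moreover have "config_eval ?R (1 :: 'a mpoly) = 1"
    using config_eval_single[of ?R 0 "1::'a"] reachable_empty[of M pr K] by simp
  ultimately show False using ps(2) by simp
qed

end

subsection \<open>The degree upper bound for Polynomial Calculus\<close>

text \<open>Tree-like derivations of degree at most \<open>d\<close> allow derived rules for single
  polynomials; they are flattened into lists only at the end.\<close>

inductive pc_derivable :: "nat \<Rightarrow> 'a::field mpoly set \<Rightarrow> 'a mpoly \<Rightarrow> bool" for d Ps where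
  axiom: "p \<in> Ps \<union> boolean_axioms \<Longrightarrow> mdegree p \<le> d \<Longrightarrow> pc_derivable d Ps p"
| linear: "pc_derivable d Ps p \<Longrightarrow> pc_derivable d Ps q \<Longrightarrow>
    mdegree (mconst \<alpha> * p + mconst \<beta> * q) \<le> d \<Longrightarrow> pc_derivable d Ps (mconst \<alpha> * p + mconst \<beta> * q)"
| mult: "pc_derivable d Ps p \<Longrightarrow> mdegree (mvar i * p) \<le> d \<Longrightarrow> pc_derivable d Ps (mvar i * p)"

text \<open>Earlier lines enter as a set instead of by index, so the condition survives
  concatenation of lists.\<close>

definition pc_line :: "'a::field mpoly set \<Rightarrow> 'a mpoly set \<Rightarrow> 'a mpoly \<Rightarrow> bool" where
  "pc_line Ps S q \<longleftrightarrow> q \<in> Ps \<union> boolean_axioms \<or>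
     (\<exists>a\<in>S. \<exists>b\<in>S. \<exists>\<alpha> \<beta>. q = mconst \<alpha> * a + mconst \<beta> * b) \<or> (\<exists>a\<in>S. \<exists>i. q = mvar i * a)"

definition pc_derivation :: "'a::field mpoly set \<Rightarrow> 'a mpoly list \<Rightarrow> bool" where
  "pc_derivation Ps ps \<longleftrightarrow> (\<forall>k<length ps. pc_line Ps (set (take k ps)) (ps ! k))"

lemma pc_line_mono: "pc_line Ps S q \<Longrightarrow> S \<subseteq> S' \<Longrightarrow> pc_line Ps S' q"
  unfolding pc_line_def by blast

lemma pc_derivation_append:
  assumes "pc_derivation Ps ps" "pc_derivation Ps qs"
  shows "pc_derivation Ps (ps @ qs)"
  unfolding pc_derivation_def
proof (intro allI impI)
  fix k assume k: "k < length (ps @ qs)"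
  show "pc_line Ps (set (take k (ps @ qs))) ((ps @ qs) ! k)"
  proof (cases "k < length ps")
    case True
    then show ?thesis using assms(1) by (simp add: pc_derivation_def nth_append)
  next
    case False
    then have "pc_line Ps (set (take (k - length ps) qs)) (qs ! (k - length ps))"
      using assms(2) k by (simp add: pc_derivation_def)
    then show ?thesis using False by (auto simp: nth_append elim: pc_line_mono)
  qed
qed

lemma pc_derivation_snoc:
  assumes "pc_derivation Ps ps" "pc_line Ps (set ps) q"
  shows "pc_derivation Ps (ps @ [q])"
  using assms by (auto simp: pc_derivation_def nth_append less_Suc_eq)

lemma pc_derivation_of_derivable:
  assumes "pc_derivable d Ps p"
  shows "\<exists>ps. ps \<noteq> [] \<and> last ps = p \<and> pc_derivation Ps ps \<and> (\<forall>q\<in>set ps. mdegree q \<le> d)"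
  using assms
proof induction
  case (axiom p)
  then show ?case by (intro exI[of _ "[p]"]) (auto simp: pc_derivation_def pc_line_def)
next
  case (linear p q \<alpha> \<beta>)
  then obtain ps qs where ps: "ps \<noteq> []" "last ps = p" "pc_derivation Ps ps" "\<forall>q\<in>set ps. mdegree q \<le> d"
    and qs: "qs \<noteq> []" "last qs = q" "pc_derivation Ps qs" "\<forall>q\<in>set qs. mdegree q \<le> d" by blast
  have "pc_line Ps (set (ps @ qs)) (mconst \<alpha> * p + mconst \<beta> * q)"
    using last_in_set[OF ps(1)] last_in_set[OF qs(1)] ps(2) qs(2) unfolding pc_line_def by auto
  then have "pc_derivation Ps ((ps @ qs) @ [mconst \<alpha> * p + mconst \<beta> * q])"
    by (intro pc_derivation_snoc pc_derivation_append ps qs)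
  then show ?case
    using ps(4) qs(4) linear.hyps
    by (intro exI[of _ "(ps @ qs) @ [mconst \<alpha> * p + mconst \<beta> * q]"]) auto
next
  case (mult p i)
  then obtain ps where ps: "ps \<noteq> []" "last ps = p" "pc_derivation Ps ps" "\<forall>q\<in>set ps. mdegree q \<le> d" by blast
  have "pc_line Ps (set ps) (mvar i * p)"
    using last_in_set[OF ps(1)] ps(2) unfolding pc_line_def by auto
  then have "pc_derivation Ps (ps @ [mvar i * p])" by (intro pc_derivation_snoc ps)
  then show ?case using ps(4) mult.hyps by (intro exI[of _ "ps @ [mvar i * p]"]) auto
qed

lemma pc_refutation_of_derivable:
  assumes "pc_derivable d Ps 1"
  obtains ps where "pc_refutation Ps ps" "refutation_degree ps \<le> d"
proof -
  obtain ps where ps: "ps \<noteq> []" "last ps = 1" "pc_derivation Ps ps" "\<forall>q\<in>set ps. mdegree q \<le> d"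
    using pc_derivation_of_derivable[OF assms] by blast
  have in_take: "\<exists>i<k. a = ps ! i" if "a \<in> set (take k ps)" for a k
    using that by (auto simp: in_set_conv_nth)
  have "ps ! k \<in> Ps \<union> boolean_axioms \<or>
        (\<exists>i<k. \<exists>j<k. \<exists>\<alpha> \<beta>. ps ! k = mconst \<alpha> * ps ! i + mconst \<beta> * ps ! j) \<or>
        (\<exists>j<k. \<exists>i. True \<and> ps ! k = mvar i * ps ! j)" if "k < length ps" for k
  proof -
    have "pc_line Ps (set (take k ps)) (ps ! k)" using ps(3) that by (simp add: pc_derivation_def)
    then consider "ps ! k \<in> Ps \<union> boolean_axioms"
      | a b \<alpha> \<beta> where "a \<in> set (take k ps)" "b \<in> set (take k ps)" "ps ! k = mconst \<alpha> * a + mconst \<beta> * b"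
      | a i where "a \<in> set (take k ps)" "ps ! k = mvar i * a"
      unfolding pc_line_def by blast
    then show ?thesis
    proof cases
      case 2
      then show ?thesis using in_take[OF 2(1)] in_take[OF 2(2)] by metis
    next
      case 3
      then show ?thesis using in_take[OF 3(1)] by metis
    qed blast
  qed
  then have "pc_refutation Ps ps"
    using ps(1,2) unfolding pc_refutation_def refutation_def by blast
  moreover have "refutation_degree ps \<le> d"
    using ps(1,4) by (auto simp: refutation_degree_def)
  ultimately show ?thesis by (rule that)
qed

section \<open>Degree estimates and derived rules of Polynomial Calculus\<close>

lemma mdegree_add_le: "mdegree p \<le> d \<Longrightarrow> mdegree q \<le> d \<Longrightarrow> mdegree (p + q) \<le> d"
  using keys_add[of p q] by (auto simp: mdegree_le_iff)

lemma mdegree_mult_le: "mdegree p \<le> d \<Longrightarrow> mdegree q \<le> e \<Longrightarrow> mdegree (p * q) \<le> d + e"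
  using keys_mult[of p q] by (fastforce simp: mdegree_le_iff monom_degree_add intro: add_mono)

lemma mdegree_single_le: "mdegree (Poly_Mapping.single m c) \<le> monom_degree m"
  by (simp add: mdegree_le_iff)

lemma mdegree_mconst_le: "mdegree (mconst c) \<le> d"
  unfolding mconst_def by (rule order_trans[OF mdegree_single_le]) (simp add: monom_degree_def)

lemma mdegree_mvar_le: "mdegree (mvar i) \<le> 1"
  unfolding mvar_def by (rule order_trans[OF mdegree_single_le]) (simp add: monom_degree_def)

lemma mconst_1: "mconst 1 = 1" and mconst_uminus_1: "mconst (- 1) = - 1"
  by (simp_all add: mconst_def single_uminus)

lemma pc_derivable_mdegree: "pc_derivable d Ps p \<Longrightarrow> mdegree p \<le> d"
  by (induction rule: pc_derivable.induct) auto

lemma pc_derivable_add: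
  assumes "pc_derivable d Ps p" "pc_derivable d Ps q"
  shows "pc_derivable d Ps (p + q)"
  using pc_derivable.linear[OF assms, of 1 1] mdegree_add_le[OF assms[THEN pc_derivable_mdegree]]
  by (simp add: mconst_1)

lemma pc_derivable_diff:
  assumes "pc_derivable d Ps p" "pc_derivable d Ps q"
  shows "pc_derivable d Ps (p - q)"
proof -
  have "mdegree (mconst (-1) * q) \<le> 0 + d"
    by (intro mdegree_mult_le mdegree_mconst_le pc_derivable_mdegree[OF assms(2)])
  then have "mdegree (mconst 1 * p + mconst (-1) * q) \<le> d"
    using pc_derivable_mdegree[OF assms(1)] by (intro mdegree_add_le) (simp_all add: mconst_1)
  then show ?thesis
    using pc_derivable.linear[OF assms, of 1 "-1"] by (simp add: mconst_1 mconst_uminus_1)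
qed

lemma mdegree_prod_mvar_le:
  assumes "finite S"
  shows "mdegree (\<Prod>y\<in>S. mvar y) \<le> card S"
  using assms
proof (induction S rule: finite_induct)
  case empty
  show ?case using mdegree_mconst_le[of 1 0] by (simp add: mconst_1)
next
  case (insert x S)
  then show ?case using mdegree_mult_le[OF mdegree_mvar_le insert.IH] by simp
qed

lemma pc_derivable_mult_prod:
  fixes p :: "'a::field mpoly"
  assumes "pc_derivable d Ps p" "finite S" "mdegree p + card S \<le> d"
  shows "pc_derivable d Ps ((\<Prod>y\<in>S. mvar y) * p)"
  using assms(2,3)
proof (induction S rule: finite_induct)
  case (insert x S)
  have "pc_derivable d Ps (mvar x * ((\<Prod>y\<in>S. mvar y) * p))"
  proof (rule pc_derivable.mult)
    show "pc_derivable d Ps ((\<Prod>y\<in>S. mvar y) * p)" using insert by simp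
    have "mdegree (mvar x * ((\<Prod>y\<in>S. mvar y) * p)) \<le> 1 + (card S + mdegree p)"
      by (intro mdegree_mult_le mdegree_mvar_le mdegree_prod_mvar_le insert.hyps order_refl)
    then show "mdegree (mvar x * ((\<Prod>y\<in>S. mvar y) * p)) \<le> d" using insert by simp
  qed
  then show ?case using insert.hyps by (simp add: mult.assoc)
qed (use assms(1) in simp)

lemma mdegree_one_minus_mvar_le: "mdegree (1 - mvar i) \<le> 1"
proof -
  have "mdegree (mconst 1 + mconst (-1) * mvar i) \<le> 1"
    using mdegree_mult_le[OF mdegree_mconst_le[of "-1" 0] mdegree_mvar_le[of i]]
    by (intro mdegree_add_le mdegree_mconst_le) simp
  then show ?thesis by (simp add: mconst_1 mconst_uminus_1)
qed

text \<open>Premises are removed one at a time. With \<open>P\<close> the product over the remaining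
  ones, \<open>(1 - x_v) * P\<close> is the sum of \<open>(1 - x_v) * (1 - x_u) * P\<close>,
  obtained from \<open>1 - x_u\<close> by multiplications, and \<open>(1 - x_v) * x_u * P\<close>.
  The degree never exceeds the number of premises plus one.\<close>

lemma pc_derivable_modus_ponens:
  fixes Ps :: "'a::field mpoly set"
  assumes "finite S" "card S < d"
    and "\<And>u. u \<in> S \<Longrightarrow> pc_derivable d Ps (1 - mvar u)"
    and "pc_derivable d Ps ((1 - mvar v) * (\<Prod>y\<in>S. mvar y))"
  shows "pc_derivable d Ps (1 - mvar v)"
  using assms
proof (induction S rule: finite_induct)
  case (insert u S)
  let ?S = "\<Prod>y\<in>S. mvar y :: 'a mpoly"
  have c: "card S + 2 \<le> d" using insert by simp
  have u: "pc_derivable d Ps (1 - mvar u)" using insert by simp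
  have deg: "mdegree (1 - mvar u :: 'a mpoly) + card S \<le> d"
    using mdegree_one_minus_mvar_le[of u, where 'a='a] c by simp
  have 1: "pc_derivable d Ps (?S * (1 - mvar u))"
    by (rule pc_derivable_mult_prod[OF u insert.hyps(1) deg])
  have "mdegree (mvar v * (?S * (1 - mvar u))) \<le> 1 + (card S + 1)"
    by (intro mdegree_mult_le mdegree_mvar_le mdegree_prod_mvar_le insert.hyps mdegree_one_minus_mvar_le)
  then have 2: "pc_derivable d Ps (mvar v * (?S * (1 - mvar u)))"
    using c by (intro pc_derivable.mult 1) simp
  have 3: "pc_derivable d Ps ((1 - mvar v) * (mvar u * ?S))"
    using insert by simp
  have "(1 - mvar v) * ?S
      = (?S * (1 - mvar u) - mvar v * (?S * (1 - mvar u))) + (1 - mvar v) * (mvar u * ?S)"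
    by (simp add: algebra_simps)
  also have "pc_derivable d Ps \<dots>"
    by (intro pc_derivable_add pc_derivable_diff 1 2 3)
  finally show ?case using insert by simp
qed simp

text \<open>The numbering of the vertices is a topological order, along which each
  \<open>1 - x_v\<close> follows from its predecessors. Adding the target axiom \<open>x_s\<close>
  to \<open>1 - x_s\<close> gives 1.\<close>

lemma pc_upper_bound:
  assumes pr: "\<And>v. v < M \<Longrightarrow> pr v \<subseteq> {..<v}" "\<And>v. v < M \<Longrightarrow> card (pr v) \<le> D" and "s < M"
  obtains ps :: "'a::field mpoly list"
  where "pc_refutation (cnf_polys (horn_cnf M pr s)) ps" "refutation_degree ps \<le> D + 1"
proof -
  let ?Ps = "cnf_polys (horn_cnf M pr s) :: 'a mpoly set"
  have "pc_derivable (D + 1) ?Ps (1 - mvar v)" if "v < M" for v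
    using that
  proof (induction v rule: less_induct)
    case (less v)
    have fin: "finite (pr v)" using pr(1)[OF less.prems] finite_subset by blast
    show ?case
    proof (rule pc_derivable_modus_ponens)
      show "finite (pr v)" "card (pr v) < D + 1" using fin pr(2)[OF less.prems] by simp_all
      show "pc_derivable (D + 1) ?Ps (1 - mvar u)" if "u \<in> pr v" for u
        using less.IH[of u] pr(1)[OF less.prems] that less.prems by auto
      show "pc_derivable (D + 1) ?Ps ((1 - mvar v) * (\<Prod>y\<in>pr v. mvar y))"
      proof (rule pc_derivable.axiom)
        have "({v}, pr v) \<in> horn_cnf M pr s" using less.prems by (simp add: horn_cnf_def)
        then have "clause_poly ({v}, pr v) \<in> ?Ps" unfolding cnf_polys_def by (rule imageI)
        then show "(1 - mvar v) * (\<Prod>y\<in>pr v. mvar y) \<in> ?Ps \<union> boolean_axioms"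
          by (simp add: clause_poly_def)
        have "mdegree ((1 - mvar v :: 'a mpoly) * (\<Prod>y\<in>pr v. mvar y)) \<le> 1 + card (pr v)"
          by (intro mdegree_mult_le mdegree_one_minus_mvar_le mdegree_prod_mvar_le fin)
        then show "mdegree ((1 - mvar v :: 'a mpoly) * (\<Prod>y\<in>pr v. mvar y)) \<le> D + 1"
          using pr(2)[OF less.prems] by simp
      qed
    qed
  qed
  then have 1: "pc_derivable (D + 1) ?Ps (1 - mvar s)" using \<open>s < M\<close> by simp
  have "clause_poly ({}, {s}) \<in> ?Ps" unfolding cnf_polys_def by (rule imageI) (simp add: horn_cnf_def)
  then have "pc_derivable (D + 1) ?Ps (mvar s)"
    using mdegree_mvar_le[of s, where 'a='a]
    by (intro pc_derivable.axiom) (simp_all add: clause_poly_target)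
  then have "pc_derivable (D + 1) ?Ps (1 - mvar s + mvar s)" by (rule pc_derivable_add[OF 1])
  then have "pc_derivable (D + 1) ?Ps 1" by simp
  then show ?thesis by (rule pc_refutation_of_derivable) (rule that)
qed

subsection \<open>The family of formulas\<close>

lemma is_cnf_horn:
  assumes "\<And>v. v < M \<Longrightarrow> finite (pr v)"
  shows "is_cnf (horn_cnf M pr s)"
  using assms by (auto simp: is_cnf_def horn_cnf_def)

lemma cnf_vars_horn:
  assumes "\<And>v. v < M \<Longrightarrow> pr v \<subseteq> {..<v}" "s < M"
  shows "cnf_vars (horn_cnf M pr s) = {..<M}"
  using assms by (fastforce simp: cnf_vars_def horn_cnf_def)

lemma unsatisfiable_horn:
  assumes "\<And>v. v < M \<Longrightarrow> pr v \<subseteq> {..<v}" "s < M"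
  shows "unsatisfiable (horn_cnf M pr s)"
  unfolding unsatisfiable_def
proof
  assume "\<exists>a. satisfies a (horn_cnf M pr s)"
  then obtain a where a: "\<not> a s" "\<And>v. v < M \<Longrightarrow> a v \<or> (\<exists>y\<in>pr v. \<not> a y)"
    by (auto simp: satisfies_def horn_cnf_def)
  have "a v" if "v < M" for v
    using that
  proof (induction v rule: less_induct)
    case (less v)
    then have "a y" if "y \<in> pr v" for y using assms(1)[of v] that by force
    then show ?case using a(2)[OF less.prems] by blast
  qed
  then show False using a(1) assms(2) by blast
qed

text \<open>The two bounds are the sizes of the hard graphs with indices \<open>i\<close> and
  \<open>i + 1\<close>, so \<open>i\<close> is the largest index whose graph has at most
  \<open>n\<close> vertices.\<close>

lemma scale_exists:
  fixes n :: nat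
  assumes "128 \<le> n"
  obtains i where "128 * 2 ^ i * (i + 1) \<le> n" "n < 256 * 2 ^ i * (i + 2)"
proof -
  define j where "j = (LEAST j. n < 128 * 2 ^ j * (j + 1))"
  have "n < 128 * 2 ^ n * (n + 1)"
  proof -
    have "n * 1 < (n + 1) * (128 * 2 ^ n)" by (rule mult_less_le_imp_less) auto
    then show ?thesis by (simp add: mult.commute)
  qed
  then have j: "n < 128 * 2 ^ j * (j + 1)" unfolding j_def by (rule LeastI)
  then obtain i where i: "j = Suc i" using assms by (cases j) auto
  have "\<not> n < 128 * 2 ^ i * (i + 1)"
    using not_less_Least[of i "\<lambda>j. n < 128 * 2 ^ j * (j + 1)"] i j_def by auto
  then show ?thesis using j i by (intro that[of i]) auto
qed

text \<open>From \<open>2 ^ (i + 2) \<le> n\<close> and \<open>ln 2 \<ge> 1/2\<close> the factor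
  \<open>i + 2\<close> is at most \<open>4 * ln n\<close>; the constant 1024 is
  \<open>256 * 4\<close>.\<close>

lemma scale_bound:
  assumes "128 \<le> n" "128 * 2 ^ i * (i + 1) \<le> n" "n < 256 * 2 ^ i * (i + 2)"
  shows "1/1024 * (real n / ln (real n)) \<le> 2 ^ i"
proof -
  have "128 * 2 ^ i \<le> n" using assms(2) by (rule order_trans[rotated]) simp
  then have "2 ^ (i + 2) \<le> n" by simp
  then have "real (2 ^ (i + 2)) \<le> real n" by (simp only: of_nat_le_iff)
  then have "ln (2 ^ (i + 2)) \<le> ln (real n)"
    by (intro ln_mono) simp_all
  then have "real (i + 2) * ln 2 \<le> ln (real n)" by (simp only: ln_realpow)
  moreover have "1 / 2 \<le> ln (2 :: real)"
    using ln_le_minus_one[of "1 / 2 :: real"] by (simp add: ln_div)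
  then have "real (i + 2) * (1 / 2) \<le> real (i + 2) * ln 2"
    by (intro mult_left_mono) simp_all
  ultimately have "real (i + 2) * (1 / 2) \<le> ln (real n)" by linarith
  then have i: "real (i + 2) \<le> 4 * ln (real n)" by simp
  then have pos: "0 < ln (real n)" by simp
  have "real n \<le> 256 * 2 ^ i * real (i + 2)"
  proof -
    have "real n \<le> real (256 * 2 ^ i * (i + 2))" using assms(3) by (simp only: of_nat_le_iff)
    then show ?thesis by (simp only: of_nat_mult of_nat_power of_nat_numeral)
  qed
  also have "\<dots> \<le> 256 * 2 ^ i * (4 * ln (real n))"
    by (intro mult_left_mono i) simp
  finally show ?thesis using pos by (simp add: field_simps)
qed

lemma hard_formula_exists:
  "\<exists>F. is_cnf F \<and> unsatisfiable F \<and> n \<le> card (cnf_vars F) \<and> card (cnf_vars F) \<le> 2 * n + 128 \<and>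
     (\<exists>ps :: 'a::field mpoly list. pc_refutation (cnf_polys F) ps \<and> refutation_degree ps \<le> 65) \<and>
     (128 \<le> n \<longrightarrow> (\<forall>ps :: 'a mpoly list. mc_refutation (cnf_polys F) ps \<longrightarrow>
        1/1024 * (real n / ln (real n)) \<le> real (refutation_degree ps)))"
proof -
  obtain i where i: "128 * 2 ^ i * (i + 1) \<le> n + 128"
    "128 \<le> n \<Longrightarrow> 1/1024 * (real n / ln (real n)) \<le> 2 ^ i"
  proof (cases "128 \<le> n")
    case True
    obtain i where "128 * 2 ^ i * (i + 1) \<le> n" "n < 256 * 2 ^ i * (i + 2)"
      by (rule scale_exists[OF True])
    then show ?thesis using scale_bound[OF True] by (intro that[of i]) auto
  next
    case False
    \<comment> \<open>For small \<open>n\<close> no lower bound is claimed and the smallest graph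
      serves.\<close>
    then show ?thesis using that[of 0] by simp
  qed
  define m where "m = 128 * 2 ^ i * (i + 1)"
  obtain pr0 where hard: "hard (2 ^ i) m pr0" using hard_exists unfolding m_def by blast
  \<comment> \<open>Padding with \<open>n\<close> isolated vertices keeps the number of variables
    between \<open>n\<close> and \<open>2 * n + 128\<close>, although the sizes of the hard graphs
    are sparse.\<close>
  define M where "M = m + n"
  define pr where "pr v = (if v < m then pr0 v else {})" for v
  have lt: "2 ^ i - 1 < (2 ^ i :: nat)" and "m \<le> M" by (simp_all add: M_def)
  obtain s where s: "s < m" "\<And>A. A \<in> reachable M pr (2 ^ i - 1) \<Longrightarrow> s \<notin> A"
    unfolding pr_def by (rule hard_unreachable[OF hard \<open>m \<le> M\<close> lt]) blast
  have pr: "pr v \<subseteq> {..<v}" "card (pr v) \<le> 64" for v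
    using hard by (auto simp: hard_def pr_def)
  have fin: "finite (pr v)" for v using pr(1) finite_subset by blast
  have "s < M" using s(1) by (simp add: M_def)
  interpret horn_pebbling M "2 ^ i - 1" s pr
    by unfold_locales (use fin s(2) in auto)
  let ?F = "horn_cnf M pr s"
  have "\<exists>ps :: 'a mpoly list. pc_refutation (cnf_polys ?F) ps \<and> refutation_degree ps \<le> 65"
  proof (rule pc_upper_bound[of M pr 64 s])
    fix ps :: "'a mpoly list"
    assume "pc_refutation (cnf_polys ?F) ps" "refutation_degree ps \<le> 64 + 1"
    then show ?thesis by (intro exI[of _ ps]) simp
  qed (use pr \<open>s < M\<close> in auto)
  moreover have "1/1024 * (real n / ln (real n)) \<le> real (refutation_degree ps)"
    if "128 \<le> n" "mc_refutation (cnf_polys ?F) ps" for ps :: "'a mpoly list"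
  proof -
    have "2 ^ i \<le> refutation_degree ps" using mc_degree_lower_bound[OF that(2)] by linarith
    then have le: "real (2 ^ i) \<le> real (refutation_degree ps)" by (simp only: of_nat_le_iff)
    have "1/1024 * (real n / ln (real n)) \<le> real (2 ^ i)" using i(2)[OF that(1)] by simp
    also note le
    finally show ?thesis .
  qed
  moreover have "cnf_vars ?F = {..<M}" using cnf_vars_horn pr(1) \<open>s < M\<close> by blast
  ultimately show ?thesis
    using is_cnf_horn[of M pr s] fin unsatisfiable_horn[of M pr s] pr(1) \<open>s < M\<close> i(1)
    by (intro exI[of _ ?F]) (simp add: M_def m_def)
qed

theorem theorem3p8:
  shows "\<exists>F :: nat \<Rightarrow> cnf.
    (\<forall>n. is_cnf (F n) \<and> unsatisfiable (F n)) \<and>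
    (\<lambda>n. real (card (cnf_vars (F n)))) \<in> \<Theta>(\<lambda>n. real n) \<and>
    (\<exists>d. \<forall>n. \<exists>ps :: 'a::field mpoly list.
        pc_refutation (cnf_polys (F n)) ps \<and> refutation_degree ps \<le> d) \<and>
    (\<exists>c::real. c > 0 \<and> (\<forall>\<^sub>F n in at_top. \<forall>ps :: 'a mpoly list.
        mc_refutation (cnf_polys (F n)) ps \<longrightarrow>
          real (refutation_degree ps) \<ge> c * (real n / ln (real n))))"
proof -
  have "\<exists>F. \<forall>n. is_cnf (F n) \<and> unsatisfiable (F n) \<and> n \<le> card (cnf_vars (F n)) \<and>
      card (cnf_vars (F n)) \<le> 2 * n + 128 \<and>
      (\<exists>ps :: 'a mpoly list. pc_refutation (cnf_polys (F n)) ps \<and> refutation_degree ps \<le> 65) \<and>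
      (128 \<le> n \<longrightarrow> (\<forall>ps :: 'a mpoly list. mc_refutation (cnf_polys (F n)) ps \<longrightarrow>
        1/1024 * (real n / ln (real n)) \<le> real (refutation_degree ps)))"
    by (intro choice allI hard_formula_exists)
  then obtain F where F: "\<And>n. is_cnf (F n)" "\<And>n. unsatisfiable (F n)"
    "\<And>n. n \<le> card (cnf_vars (F n))" "\<And>n. card (cnf_vars (F n)) \<le> 2 * n + 128"
    "\<And>n. \<exists>ps :: 'a mpoly list. pc_refutation (cnf_polys (F n)) ps \<and> refutation_degree ps \<le> 65"
    "\<And>n. 128 \<le> n \<Longrightarrow> \<forall>ps :: 'a mpoly list. mc_refutation (cnf_polys (F n)) ps \<longrightarrow>
        1/1024 * (real n / ln (real n)) \<le> real (refutation_degree ps)"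
    by blast
  have "(\<lambda>n. real (card (cnf_vars (F n)))) \<in> \<Theta>(\<lambda>n. real n)"
  proof (rule bigthetaI)
    have "\<forall>\<^sub>F n in at_top. norm (real (card (cnf_vars (F n)))) \<le> 3 * norm (real n)"
      using eventually_ge_at_top[of 128]
    proof eventually_elim
      case (elim n)
      then show ?case using F(4)[of n] by simp
    qed
    then show "(\<lambda>n. real (card (cnf_vars (F n)))) \<in> O(\<lambda>n. real n)" by (rule bigoI)
    have "\<forall>\<^sub>F n in at_top. 1 * norm (real n) \<le> norm (real (card (cnf_vars (F n))))"
      using F(3) by simp
    then show "(\<lambda>n. real (card (cnf_vars (F n)))) \<in> \<Omega>(\<lambda>n. real n)" by (rule landau_omega.bigI[rotated]) simp
  qed
  moreover have "\<forall>\<^sub>F n in at_top. \<forall>ps :: 'a mpoly list. mc_refutation (cnf_polys (F n)) ps \<longrightarrow>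
      real (refutation_degree ps) \<ge> 1/1024 * (real n / ln (real n))"
    using eventually_ge_at_top[of 128] by eventually_elim (rule F(6))
  ultimately show ?thesis
    using F(1,2,5)
    by - (rule exI[of _ F], intro conjI allI, blast, blast, blast,
        rule exI[of _ 65], blast, rule exI[of _ "1/1024"], simp)
qed

end
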